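(* For $i=1,2$ let $\mathbb{K}_i\in\mathcal{K}$, let $\eta_i:\mathbb{K}_i\to\mathbb{K}_i$ be a continuous map which is analytic on the interior of $\mathbb{K}_i$, and let $\mathcal{A}_i$ be a topological conjugacy algebra for $(\mathbb{K}_i,\eta_i)$. Assume furthermore that $\mathbb{K}_1$ is not simply connected. If the algebras $\mathcal{A}_1(A(\mathbb{K}_1))$ and $\mathcal{A}_2(A(\mathbb{K}_2))$ are isomorphic (as algebras), then there exists a homeomorphism $\gamma_s:\mathbb{K}_1\to\mathbb{K}_2$ which is analytic in the interior and satisfies $\gamma_s\circ\eta_1=\eta_2\circ\gamma_s$.
   Context: $\mathcal{K}$ is the class of subsets of $\mathbb{C}$ of the form $\mathbb{K}=\overline{G}$, where $G$ is a bounded Cauchy domain, i.e. a bounded connected open set in $\mathbb{C}$ whose boundary is the union of finitely many disjoint Jordan curves. $A(\mathbb{K})$ is the algebra of functions continuous on $\mathbb{K}$ and analytic on its interior. Isomorphisms of algebras are bijective complex algebra homomorphisms; no continuity is assumed. Topological conjugacy algebra: let $\mathcal{X}$ be compact Hausdorff and $\eta:\mathcal{X}\to\mathcal{X}$ continuous. The skew polynomial algebra $P(\mathcal{X},\eta)$ consists of all polynomials $\sum_n f_nU^n$, $f_n\in C(\mathcal{X})$, with multiplication determined by $Uf=(f\circ\eta)U$. A topological conjugacy algebra for $(\mathcal{X},\eta)$ is a complex Banach algebra $\mathcal{A}$ such that: (1) $P(\mathcal{X},\eta)$ is contained in $\mathcal{A}$ as a dense subalgebra and the constant function $1$ is the identity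 of $\mathcal{A}$; (2) $C(\mathcal{X})\subseteq\mathcal{A}$ is closed and there is an algebra homomorphism $E_0:\mathcal{A}\to C(\mathcal{X})$ with $E_0(f)=f$ for all $f\in C(\mathcal{X})$ and $\ker E_0=\mathcal{A}U$; (3) $U$ is not a right divisor of $0$ (i.e. $aU=0$ implies $a=0$); (4) $\limsup_n(\|E_n\|\,\|U^n\|)^{1/n}\le 1$, where the coefficient maps $E_n:\mathcal{A}\to C(\mathcal{X})$ (automatically bounded) are defined inductively: each $a\in\mathcal{A}$ can be written uniquely as $a=E_0(a)+bU$ with $b\in\mathcal{A}$, and $E_{n+1}(a)=E_n(b)$ for $n\ge 0$. If $\mathcal{S}\subseteq C(\mathcal{X})$ is a uniform algebra with $f\circ\eta\in\mathcal{S}$ for all $f\in\mathcal{S}$, then $\mathcal{A}(\mathcal{S})$ denotes the norm closed subalgebra of $\mathcal{A}$ generated by all polynomials $\sum_n f_nU^n$ with $f_n\in\mathcal{S}$ for all $n\ge0$. Here $\mathcal{X}=\mathbb{K}_i$, $\mathcal{S}=A(\mathbb{K}_i)$. *)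

theory Defs
  imports "HOL-Complex_Analysis.Complex_Analysis"
begin

(* Unital complex Banach algebras. The norm is submultiplicative and complete;
   the normalisation norm 1 = 1 is not assumed. *)
class complex_banach_algebra_1 = real_algebra_1 + real_normed_algebra + banach +
  fixes scaleC :: "complex \<Rightarrow> 'a \<Rightarrow> 'a"  (infixr "*\<^sub>C" 75)
  assumes scaleR_scaleC: "r *\<^sub>R a = complex_of_real r *\<^sub>C a"
    and scaleC_add_right: "c *\<^sub>C (a + b) = c *\<^sub>C a + c *\<^sub>C b"
    and scaleC_add_left: "(c + d) *\<^sub>C a = c *\<^sub>C a + d *\<^sub>C a"
    and scaleC_scaleC: "c *\<^sub>C (d *\<^sub>C a) = (c * d) *\<^sub>C a"
    and scaleC_one: "1 *\<^sub>C a = a"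
    and scaleC_mult_left: "(c *\<^sub>C a) * b = c *\<^sub>C (a * b)"
    and scaleC_mult_right: "a * (c *\<^sub>C b) = c *\<^sub>C (a * b)"
    and norm_scaleC: "norm (c *\<^sub>C a) = cmod c * norm a"

definition complex_subalgebra :: "'a::complex_banach_algebra_1 set \<Rightarrow> bool" where
  "complex_subalgebra B \<longleftrightarrow> 0 \<in> B \<and>
     (\<forall>a\<in>B. \<forall>b\<in>B. a + b \<in> B \<and> a * b \<in> B) \<and> (\<forall>c. \<forall>a\<in>B. c *\<^sub>C a \<in> B)"

definition algebra_isomorphism ::
  "'a::complex_banach_algebra_1 set \<Rightarrow> 'b::complex_banach_algebra_1 set \<Rightarrow> ('a \<Rightarrow> 'b) \<Rightarrow> bool" where
  "algebra_isomorphism A B \<phi> \<longleftrightarrow> bij_betw \<phi> A B \<and>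
     (\<forall>a\<in>A. \<forall>b\<in>A. \<phi> (a + b) = \<phi> a + \<phi> b \<and> \<phi> (a * b) = \<phi> a * \<phi> b) \<and>
     (\<forall>c. \<forall>a\<in>A. \<phi> (c *\<^sub>C a) = c *\<^sub>C \<phi> a)"

definition isomorphic_algebras ::
  "'a::complex_banach_algebra_1 set \<Rightarrow> 'b::complex_banach_algebra_1 set \<Rightarrow> bool" where
  "isomorphic_algebras A B \<longleftrightarrow> (\<exists>\<phi>. algebra_isomorphism A B \<phi>)"

definition jordan_curve :: "complex set \<Rightarrow> bool" where
  "jordan_curve C \<longleftrightarrow>
     (\<exists>g. simple_path g \<and> pathfinish g = pathstart g \<and> C = path_image g)"

definition bounded_cauchy_domain :: "complex set \<Rightarrow> bool" where
  "bounded_cauchy_domain G \<longleftrightarrow> G \<noteq> {} \<and> open G \<and> connected G \<and> bounded G \<and>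
     (\<exists>\<J>. finite \<J> \<and> (\<forall>C\<in>\<J>. jordan_curve C) \<and> pairwise disjnt \<J> \<and> frontier G = \<Union>\<J>)"

definition closed_cauchy_domains :: "complex set set" where
  "closed_cauchy_domains = closure ` {G. bounded_cauchy_domain G}"

(* Elements of C(X) and A(K) are represented by total functions; only their values on X (or K)
   matter, so two functions agreeing there stand for the same element. *)
definition cont_fun :: "'x::topological_space set \<Rightarrow> ('x \<Rightarrow> complex) set" where
  "cont_fun X = {f. continuous_on X f}"

definition analytic_fun :: "complex set \<Rightarrow> (complex \<Rightarrow> complex) set" where
  "analytic_fun K = {f. continuous_on K f \<and> f analytic_on interior K}"

(* The polynomials with coefficients in S, computed in an algebra into which the functions
   are mapped by \<iota>. *)
definition skew_polys ::
  "(('x \<Rightarrow> complex) \<Rightarrow> 'a::complex_banach_algebra_1) \<Rightarrow> 'a \<Rightarrow> ('x \<Rightarrow> complex) set \<Rightarrow> 'a set" where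
  "skew_polys \<iota> U S = {(\<Sum>n<N. \<iota> (f n) * U ^ n) | f N. \<forall>n. f n \<in> S}"

primrec coeff_map ::
  "(('x \<Rightarrow> complex) \<Rightarrow> 'a::complex_banach_algebra_1) \<Rightarrow> 'a \<Rightarrow> ('a \<Rightarrow> 'x \<Rightarrow> complex) \<Rightarrow>
    nat \<Rightarrow> 'a \<Rightarrow> 'x \<Rightarrow> complex" where
  "coeff_map \<iota> U E\<^sub>0 0 a = E\<^sub>0 a"
| "coeff_map \<iota> U E\<^sub>0 (Suc n) a = coeff_map \<iota> U E\<^sub>0 n (THE b. a = \<iota> (E\<^sub>0 a) + b * U)"

(* The operator norm of a linear map into C(X) with the supremum norm. The suprema are of
   bounded nonempty sets for the coefficient maps of a topological conjugacy algebra. *)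
definition fun_onorm ::
  "'x set \<Rightarrow> ('a::complex_banach_algebra_1 \<Rightarrow> 'x \<Rightarrow> complex) \<Rightarrow> real" where
  "fun_onorm X E = (SUP a\<in>{a. norm a \<le> 1}. SUP x\<in>X. cmod (E a x))"

(* The Banach algebra is the whole type 'a. The inclusion of the skew polynomial algebra P(X,\<eta>)
   is given by its restriction \<iota> to C(X) and by the image U of the variable: it is well defined and
   multiplicative by the assumptions from iota_cong to covariant, and injective by poly_inj.
   The homomorphism E\<^sub>0 is a parameter, but it is determined by the other data. *)
locale topological_conjugacy_algebra =
  fixes X :: "'x::t2_space set"
    and \<eta> :: "'x \<Rightarrow> 'x"
    and \<iota> :: "('x \<Rightarrow> complex) \<Rightarrow> 'a::complex_banach_algebra_1"
    and U :: 'a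
    and E\<^sub>0 :: "'a \<Rightarrow> 'x \<Rightarrow> complex"
  assumes compact_space: "compact X"
    and eta_continuous: "continuous_on X \<eta>"
    and eta_into: "\<eta> ` X \<subseteq> X"
    and iota_cong: "\<lbrakk>f \<in> cont_fun X; g \<in> cont_fun X; \<And>x. x \<in> X \<Longrightarrow> f x = g x\<rbrakk> \<Longrightarrow> \<iota> f = \<iota> g"
    and iota_add: "\<lbrakk>f \<in> cont_fun X; g \<in> cont_fun X\<rbrakk> \<Longrightarrow> \<iota> (\<lambda>x. f x + g x) = \<iota> f + \<iota> g"
    and iota_mult: "\<lbrakk>f \<in> cont_fun X; g \<in> cont_fun X\<rbrakk> \<Longrightarrow> \<iota> (\<lambda>x. f x * g x) = \<iota> f * \<iota> g"
    and iota_scale: "f \<in> cont_fun X \<Longrightarrow> \<iota> (\<lambda>x. c * f x) = c *\<^sub>C \<iota> f"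
    and iota_one: "\<iota> (\<lambda>x. 1) = 1"
    and covariant: "f \<in> cont_fun X \<Longrightarrow> U * \<iota> f = \<iota> (f \<circ> \<eta>) * U"
    and poly_inj: "\<lbrakk>\<And>n. p n \<in> cont_fun X; (\<Sum>n<N. \<iota> (p n) * U ^ n) = 0; n < N; x \<in> X\<rbrakk> \<Longrightarrow> p n x = 0"
    and polys_dense: "closure (skew_polys \<iota> U (cont_fun X)) = UNIV"
    and cont_fun_closed: "closed (\<iota> ` cont_fun X)"
    and E0_cont: "E\<^sub>0 a \<in> cont_fun X"
    and E0_add: "x \<in> X \<Longrightarrow> E\<^sub>0 (a + b) x = E\<^sub>0 a x + E\<^sub>0 b x"
    and E0_mult: "x \<in> X \<Longrightarrow> E\<^sub>0 (a * b) x = E\<^sub>0 a x * E\<^sub>0 b x"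
    and E0_scale: "x \<in> X \<Longrightarrow> E\<^sub>0 (c *\<^sub>C a) x = c * E\<^sub>0 a x"
    and E0_iota: "\<lbrakk>f \<in> cont_fun X; x \<in> X\<rbrakk> \<Longrightarrow> E\<^sub>0 (\<iota> f) x = f x"
    and E0_kernel: "{a. \<forall>x\<in>X. E\<^sub>0 a x = 0} = {b * U | b. True}"
    and U_not_right_divisor: "a * U = 0 \<Longrightarrow> a = 0"
    and coeff_growth:
      "limsup (\<lambda>n. ereal (root n (fun_onorm X (coeff_map \<iota> U E\<^sub>0 n) * norm (U ^ n)))) \<le> 1"

definition conj_subalgebra ::
  "(('x \<Rightarrow> complex) \<Rightarrow> 'a::complex_banach_algebra_1) \<Rightarrow> 'a \<Rightarrow> ('x \<Rightarrow> complex) set \<Rightarrow> 'a set" where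
  "conj_subalgebra \<iota> U S = (\<lambda>B. complex_subalgebra B \<and> closed B) hull skew_polys \<iota> U S"

end

(* Write B_i for the algebra A_i(A(K_i)). A character of B_i is given by a point x of K_i (its
   restriction to A(K_i), by Arens' theorem) together with its value w at U_i, and w = 0 unless x is
   a fixed point of eta_i; over a fixed point all w in a disc of radius rad occur, through the
   characters a |-> sum_n E_n(a)(x) w^n. An isomorphism identifies the characters, so the core K_1
   (the characters with w = 0) is mapped into the characters of B_2 by p |-> (y(p), v(p)) with y, v
   in A(K_1).

   If y is constant, K_1 is mapped bijectively onto the closed disc over one fixed point, so K_1 is
   simply connected. Otherwise, if v = 0, then y is a homeomorphism onto K_2 whose inverse comes
   from the inverse isomorphism, and the derivation E_1 shows that y intertwines eta_1 and eta_2.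
   If v is not zero, then eta_2 is the identity on an open set and hence everywhere, the algebras
   are commutative, and eta_1 is the identity as well; then the characters form products of K_i
   with a disc, and the argument of Remmert and Stein shows that v is constant, so that the slice
   over v has an inverse of y. *)
theory Submission
  imports Defs
begin

text \<open>The isomorphism is given only algebraically, so limits cannot be carried across it. Two
  kinds of data survive: characters, which are contractive on a closed subalgebra by a Neumann
  series argument and hence determined by their two coordinates, and exact identities such as the
  product rule for \<open>coeff 1\<close>. The radius \<open>rad\<close> is the spectral radius of
  U. Contractivity bounds |\<theta> U| by \<open>rad\<close>, and the growth condition makes the
  series of \<open>\<Theta>\<close> converge for |w| < rad. On the circle |w| = rad the existence of
  characters is left undecided, and this shapes the arguments: either the open mapping theorem or
  the maximum principle keeps coordinates inside the open disc, or a character on the circle is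
  approached by characters from inside. That \<open>K\<^sub>1\<close> is not simply connected
  excludes that its core is carried onto a fibre of the second algebra. A nonzero constant v remains
  possible; it means that the centres of the fibre discs are moved, and the inverse of y is then
  read off on the slice over that constant instead of on the core.\<close>

section \<open>Cauchy domains\<close>

lemma locally_path_connected_jordan_curve:
  assumes "jordan_curve C"
  shows "locally path_connected C"
proof -
  obtain g where g: "simple_path g" "pathfinish g = pathstart g" "C = path_image g"
    using assms unfolding jordan_curve_def by blast
  then have "C homeomorphic sphere (0::complex) 1"
    using homeomorphic_simple_path_image_circle[of g 1 0] by simp
  then show ?thesis
    using homeomorphic_locally[of C "sphere (0::complex) 1" path_connected path_connected]
      locally_path_connected_sphere homeomorphic_path_connectedness by blast
qed

lemma closed_jordan_curve: "jordan_curve C \<Longrightarrow> closed C"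
  unfolding jordan_curve_def using closed_simple_path_image by auto

text \<open>The Jordan curve theorem leaves two complementary components, both with frontier
  \<open>C\<close>; the connected set \<open>G\<close> lies in one of them and \<open>H\<close> is
  the other. This is how the outside of a domain is reached near a boundary point.\<close>

lemma jordan_curve_far_side:
  assumes C: "jordan_curve C" and G: "open G" "connected G" "C \<inter> G = {}"
  obtains H where "open H" "connected H" "H \<noteq> {}" "H \<inter> closure G = {}" "C \<subseteq> closure H"
proof -
  obtain g where g: "simple_path g" "pathfinish g = pathstart g" "C = path_image g"
    using C unfolding jordan_curve_def by blast
  note J = Jordan_inside_outside[OF g(1,2), folded g(3)]
  have frin: "frontier (inside C) = C" and frout: "frontier (outside C) = C"
    using J by auto
  have "G \<subseteq> inside C \<union> outside C" using J G(3) by blast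
  then have "G \<inter> inside C = {} \<or> G \<inter> outside C = {}"
    using connectedD[OF G(2), of "inside C" "outside C"] J by blast
  then obtain H where H: "open H" "connected H" "H \<noteq> {}" "H \<inter> G = {}" "C \<subseteq> closure H"
    using J frin frout closure_Un_frontier by (metis Int_commute Un_upper2)
  then have "H \<inter> closure G = {}"
    by (metis open_Int_closure_eq_empty)
  then show thesis using H that by blast
qed

text \<open>The curves not through \<open>x\<close> are finitely many closed sets, so a small ball
  around \<open>x\<close> misses all of them.\<close>

lemma cauchy_domain_boundary_curve:
  assumes G: "bounded_cauchy_domain G" and x: "x \<in> closure G" "x \<notin> G"
  obtains C where "jordan_curve C" "x \<in> C" "C \<subseteq> frontier G"
    "\<exists>d>0. frontier G \<inter> ball x d \<subseteq> C"
proof -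
  obtain \<J> where J: "finite \<J>" "\<And>C. C \<in> \<J> \<Longrightarrow> jordan_curve C" "pairwise disjnt \<J>" "frontier G = \<Union>\<J>"
    using G unfolding bounded_cauchy_domain_def by blast
  have "x \<in> frontier G"
    using x by (metis Diff_iff frontier_def interior_subset subsetD)
  then obtain C where C: "C \<in> \<J>" "x \<in> C" using J by auto
  have "closed (\<Union>(\<J> - {C}))"
    using J closed_jordan_curve by blast
  moreover have "x \<notin> \<Union>(\<J> - {C})"
    using J(3) C by (auto simp: pairwise_def disjnt_def)
  ultimately obtain d where d: "d > 0" "ball x d \<inter> \<Union>(\<J> - {C}) = {}"
    by (metis Compl_iff disjoint_eq_subset_Compl open_Compl open_contains_ball)
  then have "frontier G \<inter> ball x d \<subseteq> C" using J(4) by blast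
  then show thesis using that[of C] J C d by blast
qed

lemma frontier_inter_domain:
  assumes "bounded_cauchy_domain G" "C \<subseteq> frontier G" shows "C \<inter> G = {}"
  using assms unfolding bounded_cauchy_domain_def frontier_def by (auto simp: interior_open)

text \<open>Jordan curves leave no slits or punctures: each boundary point is a limit of the far
  side of its curve, which is open and misses \<open>closure G\<close>.\<close>

lemma interior_closure_cauchy_domain:
  assumes G: "bounded_cauchy_domain G" shows "interior (closure G) = G"
proof
  have oG: "open G" "connected G" using G unfolding bounded_cauchy_domain_def by auto
  then show "G \<subseteq> interior (closure G)"
    by (simp add: closure_subset interior_maximal)
  show "interior (closure G) \<subseteq> G"
  proof (rule ccontr)
    assume "\<not> interior (closure G) \<subseteq> G"
    then obtain x where x: "x \<in> interior (closure G)" "x \<notin> G" by blast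
    then have "x \<in> closure G" using interior_subset by blast
    then obtain C where C: "jordan_curve C" "x \<in> C" "C \<subseteq> frontier G"
      using cauchy_domain_boundary_curve[OF G _ x(2)] by metis
    obtain H where H: "open H" "H \<inter> closure G = {}" "C \<subseteq> closure H"
      using jordan_curve_far_side[OF C(1) oG frontier_inter_domain[OF G C(3)]] by metis
    then have "x \<in> interior (closure G) \<inter> closure H" using x C by blast
    then have "interior (closure G) \<inter> H \<noteq> {}"
      using open_Int_closure_eq_empty[OF open_interior] by (metis empty_iff)
    then show False using H interior_subset by blast
  qed
qed

text \<open>Serves the lifting criterion for the exponential covering. Near a boundary point
  \<open>x\<close>, a point is joined to \<open>x\<close> by going straight towards \<open>x\<close>
  until the frontier is met, which happens on the boundary curve through \<open>x\<close>, and then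
  along this curve, which is itself locally path connected.\<close>

lemma locally_path_connected_closure_cauchy_domain:
  assumes G: "bounded_cauchy_domain G"
  shows "locally path_connected (closure G)"
  unfolding locally_path_connected_im_kleinen
proof (intro allI impI)
  fix v x assume vx: "openin (top_of_set (closure G)) v \<and> x \<in> v"
  have oG: "open G" using G unfolding bounded_cauchy_domain_def by auto
  obtain e where e: "e > 0" "ball x e \<inter> closure G \<subseteq> v" and xK: "x \<in> closure G"
    using vx openin_contains_ball[of "closure G" v] by (metis subsetD)
  define Q where "Q y \<longleftrightarrow> (\<exists>p. path p \<and> path_image p \<subseteq> v \<and> pathstart p = x \<and> pathfinish p = y)" for y
  have "\<exists>d>0. \<forall>y\<in>ball x d \<inter> closure G. Q y"
  proof (cases "x \<in> G")
    case True
    then obtain d where d: "d > 0" "ball x d \<subseteq> G" using oG open_contains_ball by blast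
    have "Q y" if "y \<in> ball x (min d e) \<inter> closure G" for y
    proof -
      have "closed_segment x y \<subseteq> ball x (min d e)"
        using that d e by (intro closed_segment_subset) auto
      moreover have "ball x (min d e) \<subseteq> v"
        using d(2) e(2) closure_subset[of G] unfolding ball_min_Int by blast
      ultimately show ?thesis unfolding Q_def
        by (intro exI[of _ "linepath x y"]) auto
    qed
    then show ?thesis using d e by (intro exI[of _ "min d e"]) auto
  next
    case False
    then obtain C d where C: "jordan_curve C" "x \<in> C" "C \<subseteq> frontier G"
      and d: "d > 0" "frontier G \<inter> ball x d \<subseteq> C"
      using cauchy_domain_boundary_curve[OF G xK] by metis
    have CK: "C \<subseteq> closure G" using C(3) by (auto simp: frontier_def)
    have "openin (top_of_set C) (C \<inter> ball x e)" by auto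
    then obtain u where u: "openin (top_of_set C) u" "x \<in> u" "u \<subseteq> C \<inter> ball x e"
        "\<And>y. y \<in> u \<Longrightarrow> \<exists>p. path p \<and> path_image p \<subseteq> C \<inter> ball x e \<and> pathstart p = x \<and> pathfinish p = y"
      using locally_path_connected_jordan_curve[OF C(1)] C(2) e(1)
      unfolding locally_path_connected_im_kleinen by (metis IntI centre_in_ball)
    obtain d' where d': "d' > 0" "ball x d' \<inter> C \<subseteq> u"
      using u(1,2) openin_contains_ball[of C u] by metis
    define r where "r = min d (min d' e)"
    have r: "r > 0" "ball x r \<subseteq> ball x d" "ball x r \<subseteq> ball x d'" "ball x r \<subseteq> ball x e"
      using d d' e by (auto simp: r_def)
    have "Q y" if y: "y \<in> ball x r \<inter> closure G" for y
    proof -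
      obtain h where h: "path h" "pathstart h = y" "path_image h \<subseteq> closed_segment y x"
          "path_image h - {pathfinish h} \<subseteq> interior G" "pathfinish h \<in> frontier G"
        using exists_path_subpath_to_frontier[of "linepath y x" G] y False by auto
      have seg: "closed_segment y x \<subseteq> ball x r"
        using y r by (intro closed_segment_subset) auto
      have hf: "pathfinish h \<in> path_image h" by (rule pathfinish_in_path_image)
      then have "pathfinish h \<in> u"
        using h(3,5) seg r d(2) d'(2) by blast
      then obtain p where p: "path p" "path_image p \<subseteq> C \<inter> ball x e" "pathstart p = x" "pathfinish p = pathfinish h"
        using u(4) by blast
      have "pathfinish h \<in> closure G" using h(5) by (simp add: frontier_def)
      moreover have "interior G \<subseteq> closure G"
        using interior_subset closure_subset by (rule order_trans)
      ultimately have "path_image h \<subseteq> closure G" using h(4) by blast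
      then have "path_image h \<subseteq> v" using h(3) seg r e(2) by blast
      moreover have "path_image p \<subseteq> v" using p(2) CK e(2) by blast
      ultimately show ?thesis unfolding Q_def
        using p h by (intro exI[of _ "p +++ reversepath h"]) (auto simp: path_image_join)
    qed
    then show ?thesis using r by blast
  qed
  then obtain d where d: "d > 0" "\<And>y. y \<in> ball x d \<inter> closure G \<Longrightarrow> Q y" by blast
  show "\<exists>u. openin (top_of_set (closure G)) u \<and> x \<in> u \<and> u \<subseteq> v \<and>
        (\<forall>y. y \<in> u \<longrightarrow> (\<exists>p. path p \<and> path_image p \<subseteq> v \<and> pathstart p = x \<and> pathfinish p = y))"
    using d e xK by (intro exI[of _ "closure G \<inter> ball x (min d e)"]) (auto simp: Q_def[symmetric])
qed

section \<open>Logarithms on a closed Cauchy domain without one boundary point\<close>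

text \<open>A path from \<open>a\<close> to \<open>b\<close> outside \<open>S\<close> deforms the quotient to the constant \<open>1\<close>.\<close>
lemma continuous_log_quotient:
  fixes S :: "complex set"
  assumes \<sigma>: "path \<sigma>" "path_image \<sigma> \<inter> S = {}"
  obtains l where "continuous_on S l"
    "\<And>z. z \<in> S \<Longrightarrow> exp (l z) = (z - pathfinish \<sigma>) / (z - pathstart \<sigma>)"
proof -
  let ?f = "\<lambda>z. (z - pathfinish \<sigma>) / (z - pathstart \<sigma>)"
  have nz: "z \<noteq> \<sigma> t" if "z \<in> S" "t \<in> {0..1}" for z t
    using that \<sigma>(2) unfolding path_image_def by blast
  have st: "pathstart \<sigma> \<notin> S" using nz[of _ 0] by (auto simp: pathstart_def)
  have "\<exists>h. continuous_map (prod_topology (top_of_set {0..1::real}) (top_of_set S)) (top_of_set (-{0})) h \<and>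
          (\<forall>x\<in>S. h (0, x) = 1) \<and> (\<forall>x\<in>S. h (1, x) = ?f x)"
  proof (intro exI conjI ballI)
    let ?h = "\<lambda>x. (snd x - \<sigma> (fst x)) / (snd x - pathstart \<sigma>)"
    have "continuous_on ({0..1} \<times> S) (\<lambda>x. \<sigma> (fst x))"
      using \<sigma>(1) unfolding path_def
      by (rule continuous_on_compose2) (auto intro: continuous_on_fst continuous_on_id)
    then have "continuous_on ({0..1} \<times> S) ?h"
      using st by (intro continuous_intros) auto
    moreover have "?h \<in> {0..1} \<times> S \<rightarrow> - {0}"
      using nz st by (force simp: Pi_iff)
    ultimately show "continuous_map (prod_topology (top_of_set {0..1}) (top_of_set S)) (top_of_set (-{0})) ?h"
      by (simp flip: subtopology_Times)
    show "?h (1, x) = ?f x" for x by (simp add: pathfinish_def)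
    show "?h (0, x) = 1" if "x \<in> S" for x using that st by (auto simp: pathstart_def)
  qed
  then have "homotopic_with_canon (\<lambda>h. True) S (-{0}) (\<lambda>t. 1) ?f"
    by (subst homotopic_with) auto
  then have "\<exists>a. homotopic_with_canon (\<lambda>h. True) S (-{0}) ?f (\<lambda>t. a)"
    using homotopic_with_symD by blast
  then show thesis
    unfolding inessential_eq_continuous_logarithm using that by metis
qed

lemma path_connected_if_locally:
  fixes S :: "'a::real_normed_vector set"
  assumes "connected S" "locally path_connected S"
  shows "path_connected S"
  unfolding path_connected_component
proof (intro ballI)
  fix x y assume "x \<in> S" "y \<in> S"
  then show "path_component S x y"
  proof (rule connected_equivalence_relation[OF assms(1)])
    fix a assume a: "a \<in> S"
    then have "openin (top_of_set S) (path_component_set S a)"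
      using assms(2) by (meson locally_path_connected_2 openin_subtopology_self)
    moreover have "path_component S a a" using a by (simp add: path_component_refl_eq)
    ultimately show "\<exists>T. openin (top_of_set S) T \<and> a \<in> T \<and> (\<forall>x\<in>T. path_component S a x)"
      by (intro exI[of _ "path_component_set S a"]) auto
  qed (auto intro: path_component_sym path_component_trans)
qed

text \<open>The lifting criterion for \<open>exp\<close> asks that the images of loops lift to
  loops. A loop has compact image away from \<open>b\<close>, so logarithms on compact sets
  \<open>S\<close> suffice, and these come from a path outside \<open>S\<close> that leads from
  \<open>a\<close> on the far side to \<open>b\<close>.\<close>

lemma cauchy_domain_boundary_log:
  assumes G: "bounded_cauchy_domain G" and b: "b \<in> closure G" "b \<notin> G"
  obtains a L where "a \<notin> closure G" "continuous_on (closure G - {b}) L"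
    "\<And>z. z \<in> closure G - {b} \<Longrightarrow> exp (L z) = (z - b) / (z - a)"
proof -
  have oG: "open G" "connected G" "G \<noteq> {}" using G unfolding bounded_cauchy_domain_def by auto
  obtain C where C: "jordan_curve C" "b \<in> C" "C \<subseteq> frontier G"
    using cauchy_domain_boundary_curve[OF G b] by metis
  obtain H where H: "open H" "connected H" "H \<noteq> {}" "H \<inter> closure G = {}" "C \<subseteq> closure H"
    using jordan_curve_far_side[OF C(1) oG(1,2) frontier_inter_domain[OF G C(3)]] by metis
  obtain a where a: "a \<in> H" using H(3) by blast
  then have aK: "a \<notin> closure G" using H(4) by blast
  define U where "U = closure G - {b}"
  define f where "f z = (z - b) / (z - a)" for z
  have log_compact: "\<exists>l. continuous_on S l \<and> (\<forall>z\<in>S. exp (l z) = f z)" if S: "compact S" "S \<subseteq> U" for S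
  proof -
    have "b \<notin> S" using S(2) by (auto simp: U_def)
    then obtain d where d: "d > 0" "ball b d \<inter> S = {}"
      using compact_imp_closed[OF S(1)] by (metis Compl_iff disjoint_eq_subset_Compl open_Compl open_contains_ball)
    have "b \<in> closure H" using C H by blast
    then obtain w where w: "w \<in> H" "dist w b < d" using d(1) closure_approachable by blast
    obtain \<tau> where \<tau>: "path \<tau>" "path_image \<tau> \<subseteq> H" "pathstart \<tau> = a" "pathfinish \<tau> = w"
      using connected_open_path_connected[OF H(1,2)] a w(1) unfolding path_connected_def by blast
    \<comment> \<open>\<open>\<tau>\<close> stays off \<open>closure G\<close>; only the last
      segment may meet it, inside a ball around \<open>b\<close> that misses
      \<open>S\<close>.\<close>
    define \<sigma> where "\<sigma> = \<tau> +++ linepath w b"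
    have "closed_segment w b \<subseteq> ball b d"
      using w(2) d(1) by (intro closed_segment_subset) (auto simp: dist_commute)
    then have "path_image \<sigma> \<inter> S = {}"
      using \<tau> d(2) S(2) H(4) by (auto simp: \<sigma>_def path_image_join U_def)
    moreover have "path \<sigma>" using \<tau> by (simp add: \<sigma>_def)
    moreover have "pathstart \<sigma> = a" "pathfinish \<sigma> = b" using \<tau> by (simp_all add: \<sigma>_def)
    ultimately show ?thesis
      using continuous_log_quotient[of \<sigma> S] unfolding f_def by metis
  qed
  have cU: "continuous_on U f"
    unfolding f_def U_def using aK by (intro continuous_intros) auto
  have nz: "f z \<noteq> 0" if "z \<in> U" for z
    using aK that by (auto simp: f_def U_def)
  then have fU: "f \<in> U \<rightarrow> - {0}" by auto
  have GU: "G \<subseteq> U" "U \<subseteq> closure G" using closure_subset[of G] b(2) by (auto simp: U_def)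
  then have "connected U" using connected_intermediate_closure[OF oG(2)] by blast
  moreover have lU: "locally path_connected U"
    unfolding U_def by (intro locally_diff_closed locally_path_connected_closure_cauchy_domain[OF G]) (auto simp: b(1))
  ultimately have pU: "path_connected U"
    by (rule path_connected_if_locally)
  obtain z0 where z0: "z0 \<in> U" using oG(3) GU by blast
  obtain L where "continuous_on U L" "\<And>z. z \<in> U \<Longrightarrow> exp (L z) = f z"
  proof (rule covering_space_lift_general[OF covering_space_exp_punctured_plane _ z0 pU lU cU fU])
    show "Ln (f z0) \<in> UNIV" "f z0 = exp (Ln (f z0))" using nz[OF z0] by auto
    fix r assume r: "path r" "path_image r \<subseteq> U" "pathstart r = z0" "pathfinish r = z0"
    obtain l where l: "continuous_on (path_image r) l" "\<forall>z\<in>path_image r. exp (l z) = f z"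
      using log_compact[OF compact_path_image[OF r(1)] r(2)] by blast
    \<comment> \<open>\<open>l\<close> is single valued on the image of the loop, so the lift closes
      up; the added constant makes it start at \<open>Ln (f z0)\<close>.\<close>
    define q where "q = (\<lambda>t. l (r t) + (Ln (f z0) - l z0))"
    have z0r: "z0 \<in> path_image r" using r(3) by (metis pathstart_in_path_image)
    have "path (l \<circ> r)" using r(1) l(1) by (rule path_continuous_image)
    then have "path q" unfolding q_def path_def o_def by (intro continuous_intros)
    moreover have "pathstart q = Ln (f z0)" "pathfinish q = Ln (f z0)"
      using r(3,4) by (simp_all add: q_def pathstart_def pathfinish_def)
    moreover have expq: "exp (q t) = f (r t)" if "t \<in> {0..1}" for t
    proof -
      have "r t \<in> path_image r" using that by (auto simp: path_image_def)
      then show ?thesis using l(2) z0r nz[OF z0] by (auto simp: q_def exp_add exp_diff)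
    qed
    moreover have "homotopic_paths (- {0}) (f \<circ> r) (exp \<circ> q)"
    proof (rule homotopic_paths_eq)
      show "path (f \<circ> r)" using r(1,2) cU by (intro path_continuous_image) (auto intro: continuous_on_subset)
      show "path_image (f \<circ> r) \<subseteq> - {0}" using r(2) nz by (auto simp: path_image_compose)
      show "t \<in> {0..1} \<Longrightarrow> (f \<circ> r) t = (exp \<circ> q) t" for t using expq by simp
    qed
    ultimately show "\<exists>q. path q \<and> path_image q \<subseteq> UNIV \<and> pathstart q = Ln (f z0) \<and>
        pathfinish q = Ln (f z0) \<and> homotopic_paths (- {0}) (f \<circ> r) (exp \<circ> q)" by blast
  qed (use that in auto)
  then show thesis using that[OF aK, of L] unfolding U_def f_def by blast
qed

text \<open>Locally \<open>L\<close> is a constant plus a principal logarithm: by continuity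
  \<open>L w\<close> is within 1 < pi of \<open>L z\<close>, so \<open>Ln\<close> inverts
  \<open>exp\<close> at \<open>L w - L z\<close>.\<close>

lemma holomorphic_on_continuous_log:
  assumes S: "open S" and L: "continuous_on S L" and e: "(\<lambda>z. exp (L z)) holomorphic_on S"
  shows "L holomorphic_on S"
proof -
  have "L field_differentiable at z" if z: "z \<in> S" for z
  proof -
    define g where "g w = L z + Ln (exp (L w) / exp (L z))" for w
    have "isCont L z" using L S z continuous_on_eq_continuous_at by blast
    then obtain d where d: "d > 0" "\<And>w. dist w z < d \<Longrightarrow> dist (L w) (L z) < 1"
      unfolding continuous_at_eps_delta by (metis zero_less_one)
    obtain d' where d': "d' > 0" "ball z d' \<subseteq> S" using S z open_contains_ball by blast
    have gL: "g w = L w" if "dist w z < d" for w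
    proof -
      have "\<bar>Im (L w - L z)\<bar> < 1"
        using d(2)[OF that] abs_Im_le_cmod[of "L w - L z"] by (simp add: dist_norm)
      then have "Ln (exp (L w - L z)) = L w - L z"
        using pi_gt3 by (intro Ln_exp) linarith+
      then show ?thesis by (simp add: g_def exp_diff)
    qed
    have "exp (L z) / exp (L z) = 1" by simp
    then have "(\<lambda>w. Ln (exp (L w) / exp (L z))) field_differentiable at z"
      using e S z by (intro derivative_intros field_differentiable_compose[of "\<lambda>w. exp (L w) / exp (L z)" z Ln, unfolded o_def]
          holomorphic_on_imp_differentiable_at[OF e S z] field_differentiable_at_Ln) auto
    then have "g field_differentiable at z"
      unfolding g_def by (intro derivative_intros)
    then show ?thesis
      using field_differentiable_transform_within[of d z UNIV g L] gL d(1) by simp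
  qed
  then show ?thesis using holomorphic_on_def field_differentiable_at_within by blast
qed

section \<open>Characters of the algebra of analytic functions\<close>

lemma analytic_fun_iff: "f \<in> analytic_fun K \<longleftrightarrow> continuous_on K f \<and> f holomorphic_on interior K"
  unfolding analytic_fun_def by (simp add: analytic_on_open)

lemma analytic_fun_const [simp]: "(\<lambda>z. c) \<in> analytic_fun K"
  and analytic_fun_ident [simp]: "(\<lambda>z. z) \<in> analytic_fun K"
  by (auto simp: analytic_fun_iff intro!: holomorphic_intros continuous_intros)

lemma analytic_fun_add: "f \<in> analytic_fun K \<Longrightarrow> g \<in> analytic_fun K \<Longrightarrow> (\<lambda>z. f z + g z) \<in> analytic_fun K"
  and analytic_fun_diff: "f \<in> analytic_fun K \<Longrightarrow> g \<in> analytic_fun K \<Longrightarrow> (\<lambda>z. f z - g z) \<in> analytic_fun K"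
  and analytic_fun_mult: "f \<in> analytic_fun K \<Longrightarrow> g \<in> analytic_fun K \<Longrightarrow> (\<lambda>z. f z * g z) \<in> analytic_fun K"
  and analytic_fun_power: "f \<in> analytic_fun K \<Longrightarrow> (\<lambda>z. f z ^ n) \<in> analytic_fun K"
  by (auto simp: analytic_fun_iff intro!: holomorphic_intros continuous_intros)

lemma analytic_fun_divide:
  "f \<in> analytic_fun K \<Longrightarrow> g \<in> analytic_fun K \<Longrightarrow> (\<And>z. z \<in> K \<Longrightarrow> g z \<noteq> 0) \<Longrightarrow>
    (\<lambda>z. f z / g z) \<in> analytic_fun K"
  using interior_subset[of K]
  by (auto simp: analytic_fun_iff intro!: holomorphic_intros continuous_intros)

lemma analytic_fun_cong:
  assumes "f \<in> analytic_fun K" "\<And>z. z \<in> K \<Longrightarrow> g z = f z" shows "g \<in> analytic_fun K"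
proof -
  have "\<And>z. z \<in> interior K \<Longrightarrow> g z = f z" using assms(2) interior_subset by blast
  then show ?thesis
    using assms holomorphic_cong[of "interior K" "interior K" g f] continuous_on_cong[of K K g f]
    by (auto simp: analytic_fun_iff)
qed

locale analytic_fun_character =
  fixes K :: "complex set" and \<theta> :: "(complex \<Rightarrow> complex) \<Rightarrow> complex"
  assumes add: "f \<in> analytic_fun K \<Longrightarrow> g \<in> analytic_fun K \<Longrightarrow> \<theta> (\<lambda>z. f z + g z) = \<theta> f + \<theta> g"
    and mult: "f \<in> analytic_fun K \<Longrightarrow> g \<in> analytic_fun K \<Longrightarrow> \<theta> (\<lambda>z. f z * g z) = \<theta> f * \<theta> g"
    and scale: "f \<in> analytic_fun K \<Longrightarrow> \<theta> (\<lambda>z. c * f z) = c * \<theta> f"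
    and one: "\<theta> (\<lambda>z. 1) = 1"
    and cong: "f \<in> analytic_fun K \<Longrightarrow> (\<And>z. z \<in> K \<Longrightarrow> g z = f z) \<Longrightarrow> \<theta> g = \<theta> f"
begin

lemma const: "\<theta> (\<lambda>z. c) = c"
  using scale[of "\<lambda>z. 1" c] one by simp

lemma diff:
  assumes "f \<in> analytic_fun K" "g \<in> analytic_fun K" shows "\<theta> (\<lambda>z. f z - g z) = \<theta> f - \<theta> g"
  using add[of "\<lambda>z. f z - g z" g] assms by (simp add: analytic_fun_diff)

lemma power: "f \<in> analytic_fun K \<Longrightarrow> \<theta> (\<lambda>z. f z ^ n) = \<theta> f ^ n"
  by (induction n) (simp_all add: one mult analytic_fun_power)

text \<open>Otherwise \<open>f\<close> minus the constant \<open>\<theta> f\<close> would be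
  invertible in the algebra although \<open>\<theta>\<close> annihilates it.\<close>

lemma value_in_range:
  assumes f: "f \<in> analytic_fun K" obtains p where "p \<in> K" "\<theta> f = f p"
proof -
  have "\<theta> f \<in> f ` K"
  proof (rule ccontr)
    assume n: "\<theta> f \<notin> f ` K"
    let ?d = "\<lambda>z. f z - \<theta> f"
    have nz: "f z \<noteq> \<theta> f" if "z \<in> K" for z using n that by (metis imageI)
    have d: "?d \<in> analytic_fun K" "\<theta> ?d = 0"
      using f diff[OF f analytic_fun_const] by (simp_all add: analytic_fun_diff const)
    have g: "(\<lambda>z. 1 / ?d z) \<in> analytic_fun K"
      using nz by (intro analytic_fun_divide d) auto
    have "\<theta> (\<lambda>z. ?d z * (1 / ?d z)) = \<theta> (\<lambda>z. 1)"
      using nz by (intro cong) auto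
    then show False using mult[OF d(1) g] d(2) one by simp
  qed
  then show thesis using that by blast
qed

lemma ident_in: "\<theta> (\<lambda>z. z) \<in> K"
  using value_in_range[of "\<lambda>z. z"] by auto

text \<open>The difference quotient of \<open>f\<close> at \<open>b\<close> has a removable
  singularity and so lies in the algebra; \<open>\<theta>\<close> annihilates its product with
  \<open>z - b\<close>.\<close>

lemma eval_interior:
  assumes f: "f \<in> analytic_fun K" and b: "\<theta> (\<lambda>z. z) \<in> interior K"
  shows "\<theta> f = f (\<theta> (\<lambda>z. z))"
proof -
  define b where "b = \<theta> (\<lambda>z. z)"
  define g where "g z = (if z = b then deriv f b else (f z - f b) / (z - b))" for z
  have bi: "b \<in> interior K" using b by (simp add: b_def)
  have hg: "g holomorphic_on interior K"
    using f unfolding g_def by (intro pole_lemma_open) (auto simp: analytic_fun_iff)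
  have "continuous_on (K - {b}) (\<lambda>z. (f z - f b) / (z - b))"
    using f by (intro continuous_intros) (auto simp: analytic_fun_iff intro: continuous_on_subset)
  then have "continuous_on (K - {b}) g"
    by (rule continuous_on_eq) (auto simp: g_def)
  moreover have K: "(K - {b}) \<union> interior K = K" using bi interior_subset by blast
  moreover have "openin (top_of_set K) (K - {b})" "openin (top_of_set K) (interior K)"
    using interior_subset by (auto intro: openin_delete open_subset)
  ultimately have "continuous_on K g"
    using continuous_on_Un_local_open[of "K - {b}" "interior K" g] hg
      holomorphic_on_imp_continuous_on by metis
  then have gA: "g \<in> analytic_fun K" using hg by (simp add: analytic_fun_iff)
  have "(\<lambda>z. f b + (z - b) * g z) \<in> analytic_fun K"
    using gA by (intro analytic_fun_add analytic_fun_mult analytic_fun_diff) simp_all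
  then have "\<theta> f = \<theta> (\<lambda>z. f b + (z - b) * g z)"
    by (rule cong) (simp add: g_def)
  also have "\<dots> = f b + (\<theta> (\<lambda>z. z) - b) * \<theta> g"
    using gA by (simp add: add mult diff const analytic_fun_add analytic_fun_mult analytic_fun_diff)
  finally show ?thesis by (simp add: b_def)
qed

text \<open>With \<open>q = (z - b) / (z - a)\<close>, the roots \<open>q\<^sup>1\<^sup>/\<^sup>n\<close> lie in the kernel of the character and tend to
  \<open>1\<close> away from \<open>b\<close>, so that a function vanishing at \<open>b\<close> is a limit of elements of the kernel.\<close>
lemma eval_boundary:
  assumes G: "bounded_cauchy_domain G" "K = closure G"
    and f: "f \<in> analytic_fun K" and b: "\<theta> (\<lambda>z. z) \<notin> G"
  shows "\<theta> f = f (\<theta> (\<lambda>z. z))"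
proof (rule ccontr)
  define b where "b = \<theta> (\<lambda>z. z)"
  assume ne: "\<theta> f \<noteq> f (\<theta> (\<lambda>z. z))"
  have bK: "b \<in> K" "b \<notin> G" using ident_in b by (simp_all add: b_def)
  have iK: "interior K = G" using interior_closure_cauchy_domain[OF G(1)] G(2) by simp
  have cK: "compact K" using G unfolding bounded_cauchy_domain_def by auto
  obtain a L where aK: "a \<notin> K" and L: "continuous_on (K - {b}) L"
    and eL: "\<And>z. z \<in> K - {b} \<Longrightarrow> exp (L z) = (z - b) / (z - a)"
    using cauchy_domain_boundary_log[OF G(1), of b] bK unfolding G(2) by metis
  define q where "q z = (z - b) / (z - a)" for z
  have qA: "q \<in> analytic_fun K"
    unfolding q_def using aK by (intro analytic_fun_divide analytic_fun_diff) auto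
  have "\<theta> (\<lambda>z. q z * (z - a)) = \<theta> (\<lambda>z. z - b)"
    using aK by (intro cong analytic_fun_diff) (auto simp: q_def)
  then have "\<theta> q * (b - a) = 0"
    using qA by (simp add: mult diff const analytic_fun_diff b_def[symmetric])
  then have q0: "\<theta> q = 0" using aK bK by auto
  \<comment> \<open>An n-th root of \<open>q\<close>. The value 0 at \<open>b\<close> is its
    continuous extension, as its modulus is the n-th root of that of \<open>q\<close>.\<close>
  define p where "p n z = (if z = b then 0 else exp (L z / of_nat n))" for n z
  have pq: "p n z ^ n = q z" if "z \<in> K" "n > 0" for n z
    using that eL[of z] by (auto simp: p_def q_def exp_of_nat_mult[symmetric])
  have np: "norm (p n z) = root n (norm (q z))" if "z \<in> K" "n > 0" for n z
    using pq[OF that] that(2) by (metis norm_ge_zero norm_power real_root_power_cancel)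
  have cq: "continuous_on K q" using qA by (simp add: analytic_fun_iff)
  have pA: "p n \<in> analytic_fun K" if n: "n > 0" for n
  proof -
    have "continuous_on (K - {b}) (\<lambda>z. exp (L z / of_nat n))"
      using L n by (intro continuous_intros) auto
    then have c1: "continuous_on (K - {b}) (p n)"
      by (rule continuous_on_eq) (auto simp: p_def)
    have "continuous (at z within K) (p n)" if z: "z \<in> K" for z
    proof (cases "z = b")
      case True
      have "continuous_on K (\<lambda>z. root n (norm (q z)))"
        using cq by (intro continuous_intros)
      then have "((\<lambda>z. root n (norm (q z))) \<longlongrightarrow> 0) (at b within K)"
        using bK(1) n by (auto simp: continuous_on_def q_def dest!: bspec[of _ _ b])
      then have "(p n \<longlongrightarrow> 0) (at b within K)"
        by (rule Lim_null_comparison[rotated])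
          (use np[OF _ n] in \<open>auto simp: eventually_at_filter intro!: always_eventually\<close>)
      then show ?thesis using True by (simp add: continuous_within p_def)
    next
      case False
      then have "continuous (at z within K - {b}) (p n)"
        using c1 z by (simp add: continuous_on_eq_continuous_within)
      moreover have "at z within K - {b} = at z within K"
        using False by (intro at_within_nhd[of _ "- {b}"]) auto
      ultimately show ?thesis by (simp add: continuous_within)
    qed
    moreover have "(\<lambda>z. exp (L z / of_nat n)) holomorphic_on G"
    proof -
      have "q holomorphic_on G" using qA by (simp add: analytic_fun_iff iK)
      moreover have Gb: "G \<subseteq> K - {b}" using bK closure_subset G(2) by blast
      ultimately have "(\<lambda>z. exp (L z)) holomorphic_on G"
        using eL by (subst holomorphic_cong[of _ G _ q]) (auto simp: q_def)
      moreover have "open G" using G(1) unfolding bounded_cauchy_domain_def by blast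
      ultimately have "L holomorphic_on G"
        using holomorphic_on_continuous_log continuous_on_subset[OF L Gb] by blast
      then show ?thesis using n by (intro holomorphic_intros) auto
    qed
    then have "p n holomorphic_on G"
      using bK by (subst holomorphic_cong[of _ G _ "\<lambda>z. exp (L z / of_nat n)"]) (auto simp: p_def)
    ultimately show ?thesis
      by (simp add: analytic_fun_iff iK continuous_on_eq_continuous_within)
  qed
  have p0: "\<theta> (p n) = 0" if n: "n > 0" for n
  proof -
    have "\<theta> (p n) ^ n = \<theta> (\<lambda>z. p n z ^ n)" by (simp add: power pA[OF n])
    also have "\<dots> = \<theta> q" using pq n by (intro cong qA) auto
    finally show ?thesis using q0 n by simp
  qed
  define h where "h z = f z - f b" for z
  have hA: "h \<in> analytic_fun K" unfolding h_def using f by (intro analytic_fun_diff) auto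
  have ch: "continuous_on K h" using hA by (simp add: analytic_fun_iff)
  define c where "c = \<theta> f - f b"
  have hc: "\<theta> h = c" "c \<noteq> 0" using ne diff[OF f analytic_fun_const] by (auto simp: h_def[abs_def] c_def b_def const)
  \<comment> \<open>This replaces a norm estimate for \<open>\<theta>\<close>: the factor
    \<open>1 - p\<close> has the value 1 under \<open>\<theta>\<close>, so the product keeps the
    value \<open>c\<close> of \<open>h\<close> and must attain it on \<open>K\<close>.\<close>
  have "\<exists>z\<in>K. h z * (1 - p (Suc n) z) = c" for n
  proof -
    have gA: "(\<lambda>z. h z * (1 - p (Suc n) z)) \<in> analytic_fun K"
      using hA pA by (intro analytic_fun_mult analytic_fun_diff) auto
    have "\<theta> (\<lambda>z. h z * (1 - p (Suc n) z)) = c"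
      using hA pA by (simp add: mult diff const p0 hc analytic_fun_diff)
    then show ?thesis using value_in_range[OF gA] by metis
  qed
  then obtain s where s: "\<And>n. s n \<in> K" "\<And>n. h (s n) * (1 - p (Suc n) (s n)) = c" by metis
  obtain l r where lr: "l \<in> K" "strict_mono r" "(s \<circ> r) \<longlonglongrightarrow> l"
    using cK s(1) unfolding compact_def by metis
  obtain M where M: "\<And>z. z \<in> K \<Longrightarrow> norm (q z) \<le> M"
    using compact_imp_bounded[OF compact_continuous_image[OF cq cK]] unfolding bounded_iff by blast
  have hl: "(\<lambda>n. h (s (r n))) \<longlonglongrightarrow> h l"
    using continuous_on_tendsto_compose[OF ch lr(3)[unfolded o_def] lr(1)] s(1) by simp
  have "(\<lambda>n. h (s (r n)) * (1 - p (Suc (r n)) (s (r n)))) \<longlonglongrightarrow> 0"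
  \<comment> \<open>At \<open>b\<close> the factor \<open>h\<close> tends to 0 and the roots stay
    bounded; elsewhere the logarithms converge, so the roots tend to 1.\<close>
  proof (cases "l = b")
    case True
    have "norm (1 - p (Suc (r n)) (s (r n))) \<le> 1 + max 1 M" for n
    proof -
      have "root (Suc (r n)) (norm (q (s (r n)))) \<le> root (Suc (r n)) (max 1 M)"
        using M[OF s(1)] by (intro real_root_le_mono) (simp_all add: le_max_iff_disj)
      also have "\<dots> \<le> root 1 (max 1 M)"
        by (rule real_root_decreasing) auto
      finally have "norm (p (Suc (r n)) (s (r n))) \<le> max 1 M" using np s(1) by simp
      then show ?thesis using norm_triangle_ineq4[of 1 "p (Suc (r n)) (s (r n))"] by simp
    qed
    then have "Bseq (\<lambda>n. 1 - p (Suc (r n)) (s (r n)))" by (rule BseqI')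
    moreover have "(\<lambda>n. h (s (r n))) \<longlonglongrightarrow> 0" using hl True by (simp add: h_def)
    ultimately show ?thesis
      using bounded_bilinear.Zfun_prod_Bfun[OF bounded_bilinear_mult] by (simp add: tendsto_Zfun_iff)
  next
    case False
    have ev: "\<forall>\<^sub>F n in sequentially. s (r n) \<noteq> b"
      using tendsto_imp_eventually_ne[OF lr(3) False] by simp
    have "((\<lambda>n. L (s (r n))) \<longlongrightarrow> L l) sequentially"
      using continuous_on_tendsto_compose[OF L lr(3)[unfolded o_def]] False lr(1) ev s(1)
      by (simp add: eventually_mono)
    moreover have "(\<lambda>n. inverse (of_nat (Suc (r n))) :: complex) \<longlonglongrightarrow> 0"
      using filterlim_compose[OF lim_inverse_n filterlim_compose[OF filterlim_Suc filterlim_subseq[OF lr(2)]]]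
      by simp
    ultimately have "(\<lambda>n. exp (L (s (r n)) * inverse (of_nat (Suc (r n))))) \<longlonglongrightarrow> exp (L l * 0)"
      by (intro tendsto_intros)
    then have "(\<lambda>n. exp (L (s (r n)) * inverse (of_nat (Suc (r n))))) \<longlonglongrightarrow> 1" by simp
    moreover have "\<forall>\<^sub>F n in sequentially.
        exp (L (s (r n)) * inverse (of_nat (Suc (r n)))) = p (Suc (r n)) (s (r n))"
      using ev by eventually_elim (simp add: p_def divide_inverse)
    ultimately have "(\<lambda>n. p (Suc (r n)) (s (r n))) \<longlonglongrightarrow> 1"
      by (rule Lim_transform_eventually)
    then have "(\<lambda>n. h (s (r n)) * (1 - p (Suc (r n)) (s (r n)))) \<longlonglongrightarrow> h l * (1 - 1)"
      by (intro tendsto_intros hl)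
    then show ?thesis by simp
  qed
  then show False using s(2) hc(2) by (simp add: LIMSEQ_const_iff)
qed

lemma eval:
  assumes "K \<in> closed_cauchy_domains" "f \<in> analytic_fun K"
  shows "\<theta> f = f (\<theta> (\<lambda>z. z))"
proof -
  obtain G where G: "bounded_cauchy_domain G" "K = closure G"
    using assms(1) unfolding closed_cauchy_domains_def by blast
  then show ?thesis
    using eval_boundary[OF G assms(2)] eval_interior[OF assms(2)]
      interior_closure_cauchy_domain[OF G(1)] by blast
qed

end

section \<open>Closed graph theorem and characters of Banach algebras\<close>

text \<open>Baire's theorem gives a ball in the closure of a set on which \<open>T\<close> is
  bounded; by scaling, each \<open>z\<close> is approximated up to half its norm by a vector with
  controlled image. Iterating on the remainders gives a series, and the closed graph lets
  \<open>T\<close> be applied to its sum.\<close>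

lemma closed_graph_bounded:
  fixes T :: "'a::banach \<Rightarrow> 'b::banach"
  assumes T: "linear T"
    and graph: "\<And>s a t. s \<longlonglongrightarrow> a \<Longrightarrow> (\<lambda>n. T (s n)) \<longlonglongrightarrow> t \<Longrightarrow> T a = t"
  obtains C where "C > 0" "\<And>a. norm (T a) \<le> C * norm a"
proof -
  interpret linear T by (rule T)
  define W where "W n = closure {a. norm (T a) \<le> real n}" for n
  have "\<Union>(range W) = UNIV"
  proof -
    have "a \<in> W (nat \<lceil>norm (T a)\<rceil>)" for a
      unfolding W_def by (intro closure_subset[THEN subsetD]) (auto simp: real_nat_ceiling_ge)
    then show ?thesis by blast
  qed
  then obtain n where "euclidean interior_of (W n) \<noteq> {}"
    using Baire_category_alt[of "euclidean :: 'a topology" "range W"] completely_metrizable_space_euclidean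
    by (auto simp: W_def)
  then obtain y e where e: "e > 0" "ball y e \<subseteq> W n"
    unfolding interior_of_def by (auto simp: open_contains_ball) (meson order_trans)
  \<comment> \<open>Scaling \<open>z\<close> by \<open>e / (2 * norm z)\<close> keeps the translated
    centre in the ball; the difference of two approximations has an image of norm at most
    \<open>2 * n\<close>, and undoing the scaling gives \<open>4 * n / e\<close>.\<close>
  define M where "M = 4 * real n / e"
  have step: "\<exists>x. norm (T x) \<le> M * norm z \<and> norm (z - x) \<le> norm z / 2" for z
  proof (cases "z = 0")
    case True
    then show ?thesis by (intro exI[of _ 0]) (simp add: zero)
  next
    case False
    define t where "t = e / (2 * norm z)"
    have t: "t > 0" using False e by (simp add: t_def)
    have nt: "t * norm z = e / 2" using False by (simp add: t_def)
    have "y \<in> W n" using e by auto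
    then obtain b where b: "norm (T b) \<le> real n" "dist b y < e / 8"
      unfolding W_def closure_approachable using e(1) by (metis mem_Collect_eq zero_less_divide_iff zero_less_numeral)
    have "norm (t *\<^sub>R z) < e" using nt t e(1) by simp
    then have "y + t *\<^sub>R z \<in> ball y e" by (simp add: dist_norm)
    then have "y + t *\<^sub>R z \<in> W n" using e(2) by blast
    then obtain a where a: "norm (T a) \<le> real n" "dist a (y + t *\<^sub>R z) < e / 8"
      unfolding W_def closure_approachable using e(1) by (metis mem_Collect_eq zero_less_divide_iff zero_less_numeral)
    define x where "x = (1 / t) *\<^sub>R (a - b)"
    have "norm (T x) = (1 / t) * norm (T a - T b)"
      using t by (simp add: x_def scale diff)
    also have "\<dots> \<le> (1 / t) * (2 * real n)"
      using a(1) b(1) t norm_triangle_ineq4[of "T a" "T b"] by (intro mult_left_mono) auto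
    also have "\<dots> = M * norm z" using False e(1) by (simp add: t_def M_def field_simps)
    finally have 1: "norm (T x) \<le> M * norm z" .
    have "z - x = (1 / t) *\<^sub>R ((b - y) - (a - (y + t *\<^sub>R z)))"
      using t by (simp add: x_def algebra_simps)
    then have "norm (z - x) = (1 / t) * norm ((b - y) - (a - (y + t *\<^sub>R z)))"
      using t by simp
    also have "\<dots> \<le> (1 / t) * (e / 4)"
      using a(2) b(2) t norm_triangle_ineq4[of "b - y" "a - (y + t *\<^sub>R z)"]
      by (intro mult_left_mono) (auto simp: dist_norm)
    also have "\<dots> = norm z / 2" using False e(1) by (simp add: t_def field_simps)
    finally show ?thesis using 1 by blast
  qed
  then obtain g where g: "\<And>z. norm (T (g z)) \<le> M * norm z" "\<And>z. norm (z - g z) \<le> norm z / 2"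
    by metis
  have M0: "M \<ge> 0" using e by (simp add: M_def)
  \<comment> \<open>The geometric series contributes \<open>2 * M\<close>; the added 1 makes the
    constant positive even if \<open>M\<close> is 0.\<close>
  have "norm (T a) \<le> (2 * M + 1) * norm a" for a
  proof -
    define z where "z = rec_nat a (\<lambda>_ z. z - g z)"
    have z0: "z 0 = a" and zS: "z (Suc k) = z k - g (z k)" for k by (simp_all add: z_def)
    have nz: "norm (z k) \<le> norm a * (1/2) ^ k" for k
    proof (induction k)
      case (Suc k)
      have "norm (z (Suc k)) \<le> norm (z k) / 2" using g(2) zS by simp
      then show ?case using Suc by simp
    qed (simp add: z0)
    have nT: "norm (T (g (z k))) \<le> M * norm a * (1/2) ^ k" for k
      using order_trans[OF g(1) mult_left_mono[OF nz M0]] by (simp add: mult.assoc)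
    have sg: "summable (\<lambda>k. M * norm a * (1/2) ^ k :: real)"
      by (intro summable_mult summable_geometric) simp
    have sn: "summable (\<lambda>k. norm (T (g (z k))))"
      by (rule summable_comparison_test'[OF sg]) (use nT in auto)
    then have sT: "summable (\<lambda>k. T (g (z k)))" by (rule summable_norm_cancel)
    have ps: "(\<Sum>k<n. g (z k)) = a - z n" for n
      by (induction n) (simp_all add: z0 zS)
    have "(\<lambda>n. norm a * (1/2) ^ n) \<longlonglongrightarrow> norm a * 0"
      by (intro tendsto_intros LIMSEQ_power_zero) simp
    then have "z \<longlonglongrightarrow> 0"
      using nz by (intro Lim_null_comparison[of z "\<lambda>n. norm a * (1/2) ^ n"]) auto
    then have "(\<lambda>n. \<Sum>k<n. g (z k)) \<longlonglongrightarrow> a - 0"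
      unfolding ps by (intro tendsto_intros)
    moreover have "(\<lambda>n. T (\<Sum>k<n. g (z k))) \<longlonglongrightarrow> (\<Sum>k. T (g (z k)))"
      using summable_LIMSEQ[OF sT] by (simp add: sum)
    ultimately have "T a = (\<Sum>k. T (g (z k)))" using graph by simp
    then have "norm (T a) \<le> (\<Sum>k. norm (T (g (z k))))" using summable_norm[OF sn] by simp
    also have "\<dots> \<le> (\<Sum>k. M * norm a * (1/2) ^ k)" by (rule suminf_le[OF nT sn sg])
    also have "\<dots> = M * norm a * 2"
      by (subst suminf_mult) (auto simp: suminf_geometric)
    finally show ?thesis by (simp add: algebra_simps add_increasing)
  qed
  then show thesis using M0 by (intro that[of "2 * M + 1"]) auto
qed

definition character_on :: "'a::complex_banach_algebra_1 set \<Rightarrow> ('a \<Rightarrow> complex) \<Rightarrow> bool" where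
  "character_on B \<theta> \<longleftrightarrow>
     (\<forall>a\<in>B. \<forall>b\<in>B. \<theta> (a + b) = \<theta> a + \<theta> b \<and> \<theta> (a * b) = \<theta> a * \<theta> b) \<and>
     (\<forall>c. \<forall>a\<in>B. \<theta> (c *\<^sub>C a) = c * \<theta> a) \<and> \<theta> 1 = 1"

lemma scaleC_zero_left [simp]: "0 *\<^sub>C a = 0"
  using scaleC_add_left[of 0 0 a] by simp

lemma scaleC_minus_one: "(-1) *\<^sub>C a = - a"
  using scaleC_add_left[of "-1" 1 a] by (simp add: scaleC_one eq_neg_iff_add_eq_0)

text \<open>The exponent starts at 1 because \<open>norm 1 = 1\<close> is not assumed.\<close>

lemma norm_power_Suc_le:
  fixes a :: "'a::complex_banach_algebra_1"
  shows "norm (a ^ Suc n) \<le> norm a ^ Suc n"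
proof (induction n)
  case (Suc n)
  have "norm (a ^ Suc (Suc n)) \<le> norm a * norm (a ^ Suc n)"
    unfolding power_Suc[of a "Suc n"] by (rule norm_mult_ineq)
  also have "\<dots> \<le> norm a * norm a ^ Suc n" by (intro mult_left_mono Suc) auto
  finally show ?case by simp
qed simp

lemma complex_subalgebra_diff:
  assumes "complex_subalgebra B" "a \<in> B" "b \<in> B" shows "a - b \<in> B"
  using assms scaleC_minus_one[of b] unfolding complex_subalgebra_def by (metis diff_conv_add_uminus)

text \<open>After scaling, a counterexample \<open>b\<close> has norm below 1 and value 1. The
  series \<open>s\<close> of its powers lies in \<open>B\<close> and satisfies
  \<open>s = b + b * s\<close>, so \<open>\<theta>\<close> would give
  \<open>\<theta> s = 1 + \<theta> s\<close>. The series starts with \<open>b\<close> because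
  \<open>B\<close> need not contain 1.\<close>

lemma character_on_norm_le:
  assumes B: "complex_subalgebra B" "closed B" and \<theta>: "character_on B \<theta>" and a: "a \<in> B"
  shows "cmod (\<theta> a) \<le> norm a"
proof (rule ccontr)
  assume "\<not> ?thesis"
  then have lt: "norm a < cmod (\<theta> a)" by simp
  define b where "b = inverse (\<theta> a) *\<^sub>C a"
  have nz: "\<theta> a \<noteq> 0" using lt by auto
  have b: "b \<in> B" "\<theta> b = 1"
    using B(1) a \<theta> nz unfolding b_def complex_subalgebra_def character_on_def by auto
  have "norm b = norm a / cmod (\<theta> a)"
    by (simp add: b_def norm_scaleC norm_inverse divide_inverse mult.commute)
  then have nb: "norm b < 1" using lt nz by simp
  have "summable (\<lambda>n. norm b ^ Suc n)"
    using nb by (subst summable_Suc_iff) (simp add: summable_geometric)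
  then have "summable (\<lambda>n. norm (b ^ Suc n))"
    by (rule summable_comparison_test') (use norm_power_Suc_le in auto)
  then have sb: "summable (\<lambda>n. b ^ Suc n)" by (rule summable_norm_cancel)
  define s where "s = (\<Sum>n. b ^ Suc n)"
  have pw: "b ^ Suc n \<in> B" for n
    by (induction n) (use B(1) b in \<open>auto simp: complex_subalgebra_def\<close>)
  have "(\<Sum>n<N. b ^ Suc n) \<in> B" for N
    by (induction N) (use B(1) pw in \<open>auto simp: complex_subalgebra_def\<close>)
  then have sB: "s \<in> B"
    unfolding s_def by (rule closed_sequentially[OF B(2) _ summable_LIMSEQ[OF sb]])
  have "b * s = (\<Sum>n. b * b ^ Suc n)" unfolding s_def by (rule suminf_mult[OF sb, symmetric])
  also have "\<dots> = (\<Sum>n. b ^ Suc (Suc n))" by simp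
  finally have "s = b + b * s"
    using suminf_split_head[OF sb] by (simp add: s_def)
  moreover have "b * s \<in> B" using B(1) b sB unfolding complex_subalgebra_def by blast
  ultimately have "\<theta> s = \<theta> b + \<theta> b * \<theta> s"
    using \<theta> b sB unfolding character_on_def by metis
  then show False using b by simp
qed

lemma character_on_diff:
  assumes "complex_subalgebra B" "character_on B \<theta>" "a \<in> B" "b \<in> B"
  shows "\<theta> (a - b) = \<theta> a - \<theta> b"
proof -
  have "(-1) *\<^sub>C b \<in> B" using assms unfolding complex_subalgebra_def by blast
  then have "\<theta> (a + (-1) *\<^sub>C b) = \<theta> a + (-1) * \<theta> b"
    using assms unfolding character_on_def by metis
  then show ?thesis by (simp add: scaleC_minus_one)
qed

lemma complex_subalgebra_UNIV: "complex_subalgebra UNIV"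
  by (simp add: complex_subalgebra_def)

section \<open>Topological conjugacy algebras\<close>

context topological_conjugacy_algebra
begin

abbreviation coeff :: "nat \<Rightarrow> 'a \<Rightarrow> 'x \<Rightarrow> complex" where
  "coeff n a \<equiv> coeff_map \<iota> U E\<^sub>0 n a"

text \<open>Removal of the constant term followed by cancellation of \<open>U\<close> on the right:
  the backward shift on coefficients.\<close>

definition tail :: "'a \<Rightarrow> 'a" where
  "tail a = (THE b. a = \<iota> (E\<^sub>0 a) + b * U)"

lemma cont_fun_const [simp]: "(\<lambda>x. c) \<in> cont_fun X"
  by (simp add: cont_fun_def)

lemma cont_fun_add: "f \<in> cont_fun X \<Longrightarrow> g \<in> cont_fun X \<Longrightarrow> (\<lambda>x. f x + g x) \<in> cont_fun X"
  and cont_fun_mult: "f \<in> cont_fun X \<Longrightarrow> g \<in> cont_fun X \<Longrightarrow> (\<lambda>x. f x * g x) \<in> cont_fun X"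
  by (auto simp: cont_fun_def intro!: continuous_intros)

lemma cont_fun_eta: "f \<in> cont_fun X \<Longrightarrow> f \<circ> \<eta> \<in> cont_fun X"
  unfolding cont_fun_def using eta_continuous eta_into continuous_on_compose continuous_on_subset by blast

lemma eta_in: "x \<in> X \<Longrightarrow> \<eta> x \<in> X"
  using eta_into by blast

lemma E0_character: "x \<in> X \<Longrightarrow> character_on UNIV (\<lambda>a. E\<^sub>0 a x)"
  unfolding character_on_def using E0_add E0_mult E0_scale E0_iota[of "\<lambda>x. 1"] iota_one by simp

lemma E0_norm_le: "x \<in> X \<Longrightarrow> cmod (E\<^sub>0 a x) \<le> norm a"
  using character_on_norm_le[OF complex_subalgebra_UNIV closed_UNIV E0_character] by simp

lemma E0_diff: "x \<in> X \<Longrightarrow> E\<^sub>0 (a - b) x = E\<^sub>0 a x - E\<^sub>0 b x"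
  using character_on_diff[OF complex_subalgebra_UNIV E0_character] by simp

lemma E0_mult_U: "x \<in> X \<Longrightarrow> E\<^sub>0 (b * U) x = 0"
  using E0_kernel by blast

lemma E0_U: "x \<in> X \<Longrightarrow> E\<^sub>0 U x = 0"
  using E0_mult_U[of x 1] by simp

lemma tail_eqI:
  assumes "f \<in> cont_fun X" "a = \<iota> f + b * U" shows "tail a = b"
proof -
  have "E\<^sub>0 a x = f x" if "x \<in> X" for x
    using assms that by (simp add: E0_add E0_iota E0_mult_U)
  then have "\<iota> (E\<^sub>0 a) = \<iota> f" using assms(1) by (intro iota_cong E0_cont) auto
  moreover have "c = b" if "c * U = b * U" for c
    using that U_not_right_divisor[of "c - b"] by (simp add: algebra_simps)
  ultimately show ?thesis unfolding tail_def using assms(2) by (intro the_equality) auto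
qed

lemma tail_decomp: "a = \<iota> (E\<^sub>0 a) + tail a * U"
proof -
  have "E\<^sub>0 (a - \<iota> (E\<^sub>0 a)) x = 0" if "x \<in> X" for x
    using that by (simp add: E0_diff E0_iota E0_cont)
  then obtain b where "a - \<iota> (E\<^sub>0 a) = b * U" using E0_kernel by blast
  then have "a = \<iota> (E\<^sub>0 a) + b * U" by (simp add: algebra_simps)
  then show ?thesis using tail_eqI[OF E0_cont] by metis
qed

lemma coeff_Suc: "coeff (Suc n) a = coeff n (tail a)"
  by (simp add: tail_def)

lemma iota_zero: "\<iota> (\<lambda>x. 0) = 0"
  using iota_scale[of "\<lambda>x. 1" 0] by simp

lemma tail_iota: "f \<in> cont_fun X \<Longrightarrow> tail (\<iota> f) = 0"
  by (rule tail_eqI) auto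

lemma tail_mult_U: "tail (b * U) = b"
  by (rule tail_eqI[of "\<lambda>x. 0"]) (simp_all add: iota_zero)

lemma tail_add: "tail (a + b) = tail a + tail b"
proof (rule tail_eqI[OF cont_fun_add[OF E0_cont[of a] E0_cont[of b]]])
  show "a + b = \<iota> (\<lambda>x. E\<^sub>0 a x + E\<^sub>0 b x) + (tail a + tail b) * U"
    using arg_cong2[OF tail_decomp[of a] tail_decomp[of b], of "(+)"]
      iota_add[OF E0_cont[of a] E0_cont[of b]]
    by (simp add: algebra_simps)
qed

lemma tail_scale: "tail (c *\<^sub>C a) = c *\<^sub>C tail a"
proof (rule tail_eqI[OF cont_fun_mult[OF cont_fun_const[of c] E0_cont[of a]]])
  show "c *\<^sub>C a = \<iota> (\<lambda>x. c * E\<^sub>0 a x) + (c *\<^sub>C tail a) * U"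
    using tail_decomp[of a] iota_scale[OF E0_cont, of c a]
    by (metis scaleC_add_right scaleC_mult_left)
qed

text \<open>Since \<open>U\<close> can be cancelled on the right, this is the only solution
  \<open>c\<close> of \<open>U * b = c * U\<close>; it extends composition with
  \<open>\<eta>\<close> from the functions to the whole algebra.\<close>

definition shift :: "'a \<Rightarrow> 'a" where
  "shift b = \<iota> (E\<^sub>0 b \<circ> \<eta>) + U * tail b"

lemma U_mult: "U * b = shift b * U"
proof -
  have "U * b = U * \<iota> (E\<^sub>0 b) + U * tail b * U"
    using tail_decomp[of b] by (metis distrib_left mult.assoc)
  then show ?thesis using covariant[OF E0_cont] by (simp add: shift_def distrib_right)
qed

lemma E0_shift: "x \<in> X \<Longrightarrow> E\<^sub>0 (shift b) x = E\<^sub>0 b (\<eta> x)"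
  by (simp add: shift_def E0_add E0_mult E0_U E0_iota cont_fun_eta E0_cont)

lemma tail_shift: "tail (shift b) = shift (tail b)"
  unfolding shift_def[of b] U_mult by (rule tail_eqI[OF cont_fun_eta[OF E0_cont] refl])

text \<open>A Leibniz rule twisted by \<open>shift\<close>, because \<open>U\<close> has to pass
  \<open>b\<close> before it can be split off on the right. The product rules for the coefficients
  follow from it.\<close>

lemma tail_mult: "tail (a * b) = \<iota> (E\<^sub>0 a) * tail b + tail a * shift b"
proof (rule tail_eqI[OF cont_fun_mult[OF E0_cont[of a] E0_cont[of b]]])
  have "a * b = \<iota> (E\<^sub>0 a) * b + tail a * (U * b)"
    using tail_decomp[of a] by (metis distrib_right mult.assoc)
  also have "\<iota> (E\<^sub>0 a) * b = \<iota> (E\<^sub>0 a) * \<iota> (E\<^sub>0 b) + \<iota> (E\<^sub>0 a) * tail b * U"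
    using tail_decomp[of b] by (metis distrib_left mult.assoc)
  finally show "a * b = \<iota> (\<lambda>x. E\<^sub>0 a x * E\<^sub>0 b x) + (\<iota> (E\<^sub>0 a) * tail b + tail a * shift b) * U"
    unfolding U_mult by (simp add: iota_mult E0_cont algebra_simps)
qed

lemma coeff_add: "x \<in> X \<Longrightarrow> coeff n (a + b) x = coeff n a x + coeff n b x"
  by (induction n arbitrary: a b) (simp_all add: coeff_Suc tail_add E0_add del: coeff_map.simps(2))

lemma coeff_scale: "x \<in> X \<Longrightarrow> coeff n (c *\<^sub>C a) x = c * coeff n a x"
  by (induction n arbitrary: a) (simp_all add: coeff_Suc tail_scale E0_scale del: coeff_map.simps(2))

lemma coeff_shift: "x \<in> X \<Longrightarrow> coeff n (shift b) x = coeff n b (\<eta> x)"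
  by (induction n arbitrary: b) (simp_all add: coeff_Suc tail_shift E0_shift del: coeff_map.simps(2))

lemma coeff_iota_mult:
  assumes "f \<in> cont_fun X" "x \<in> X" shows "coeff n (\<iota> f * a) x = f x * coeff n a x"
proof (induction n arbitrary: a)
  case (Suc n)
  have "\<iota> (E\<^sub>0 (\<iota> f)) = \<iota> f" using assms(1) by (intro iota_cong E0_cont) (auto simp: E0_iota)
  then have "tail (\<iota> f * a) = \<iota> f * tail a" using assms(1) by (simp add: tail_mult tail_iota)
  then show ?case using Suc by (simp add: coeff_Suc del: coeff_map.simps(2))
qed (simp add: assms E0_mult E0_iota)

text \<open>At a fixed point of \<open>\<eta>\<close> the coefficients multiply as those of a power series, hence the
  characters \<open>\<Theta>\<close> below.\<close>
lemma coeff_mult_fixed: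
  assumes x: "x \<in> X" "\<eta> x = x"
  shows "coeff n (a * b) x = (\<Sum>k\<le>n. coeff k a x * coeff (n - k) b x)"
proof (induction n arbitrary: a b)
  case 0
  then show ?case using x by (simp add: E0_mult)
next
  case (Suc n)
  have "coeff n (tail a * shift b) x = (\<Sum>k\<le>n. coeff (Suc k) a x * coeff (n - k) b x)"
    using x by (simp add: coeff_Suc Suc coeff_shift del: coeff_map.simps(2))
  then have "coeff (Suc n) (a * b) x = E\<^sub>0 a x * coeff (Suc n) b x + (\<Sum>k\<le>n. coeff (Suc k) a x * coeff (n - k) b x)"
    using x(1) by (simp only: coeff_Suc tail_mult coeff_add coeff_iota_mult[OF E0_cont])
  then show ?case by (subst sum.atMost_Suc_shift) simp
qed

lemma coeff_1_mult:
  assumes "x \<in> X"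
  shows "coeff 1 (a * b) x = E\<^sub>0 a x * coeff 1 b x + coeff 1 a x * E\<^sub>0 b (\<eta> x)"
  using assms coeff_Suc[of 0]
  by (simp add: tail_mult coeff_add[of _ 0, simplified] E0_add E0_mult E0_shift E0_iota E0_cont)

lemma coeff_cont: "coeff n a \<in> cont_fun X"
  by (induction n arbitrary: a) (simp_all add: coeff_Suc E0_cont del: coeff_map.simps(2))

text \<open>The graph is closed because the functions form a closed set: if \<open>s n\<close> and
  \<open>tail (s n)\<close> converge, so do the constant terms, again to a function, and the
  decomposition of the limit is unique. The bound yields the positivity of \<open>rad\<close> and
  the finiteness of the coefficient norms.\<close>

lemma tail_bounded: "\<exists>C>0. \<forall>a. norm (tail a) \<le> C * norm a"
proof -
  have lin: "linear tail"
    by (rule linearI) (simp_all add: tail_add scaleR_scaleC tail_scale)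
  have "tail a = t" if s: "s \<longlonglongrightarrow> a" "(\<lambda>n. tail (s n)) \<longlonglongrightarrow> t" for s a t
  proof -
    have eq: "\<iota> (E\<^sub>0 (s n)) = s n - tail (s n) * U" for n
      using tail_decomp[of "s n"] by (simp add: algebra_simps)
    have "(\<lambda>n. \<iota> (E\<^sub>0 (s n))) \<longlonglongrightarrow> a - t * U"
      unfolding eq using s by (intro tendsto_intros)
    then have "a - t * U \<in> \<iota> ` cont_fun X"
      by (rule closed_sequentially[OF cont_fun_closed, rotated]) (use E0_cont in blast)
    then obtain f where f: "f \<in> cont_fun X" "a - t * U = \<iota> f" by blast
    then have "a = \<iota> f + t * U" by (simp add: algebra_simps)
    with f(1) show ?thesis by (rule tail_eqI)
  qed
  then show ?thesis using closed_graph_bounded[OF lin] by metis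
qed

section \<open>Power series characters and their radius\<close>

text \<open>The spectral radius of \<open>U\<close>. The index 0 is left out because
  \<open>root 0\<close> is constantly 0 and would make the infimum 0.\<close>

definition rad :: real where
  "rad = (INF n\<in>{1..}. root n (norm (U ^ n)))"

lemma rad_le: "n > 0 \<Longrightarrow> rad \<le> root n (norm (U ^ n))"
  unfolding rad_def by (rule cINF_lower[where x=n]) (auto intro!: bdd_belowI2[where m=0])

lemma rad_greatest:
  assumes "\<And>n. n > 0 \<Longrightarrow> t \<le> root n (norm (U ^ n))" shows "t \<le> rad"
  unfolding rad_def using assms by (intro cINF_greatest) auto

lemma rad_power_le: assumes "n > 0" shows "rad ^ n \<le> norm (U ^ n)"
proof -
  have "rad \<ge> 0" by (rule rad_greatest) simp
  then show ?thesis using power_mono[OF rad_le[OF assms], of n] assms by simp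
qed

text \<open>\<open>tail\<close> takes \<open>U ^ Suc n\<close> to \<open>U ^ n\<close>, so the norms
  of the powers of \<open>U\<close> decrease at most geometrically with the ratio
  \<open>1 / C\<close>, where \<open>C\<close> bounds \<open>tail\<close>.\<close>

lemma rad_pos: "rad > 0"
proof -
  obtain C where C: "C > 0" "\<And>a. norm (tail a) \<le> C * norm a" using tail_bounded by blast
  have p: "norm (1::'a) \<le> C ^ n * norm (U ^ n)" for n
  proof (induction n)
    case (Suc n)
    have "norm (U ^ n) \<le> C * norm (U ^ Suc n)"
      using C(2)[of "U ^ Suc n"] by (simp add: power_Suc2 tail_mult_U del: power_Suc)
    then have "C ^ n * norm (U ^ n) \<le> C ^ n * (C * norm (U ^ Suc n))"
      using C(1) by (intro mult_left_mono) auto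
    then show ?case using Suc by (simp add: mult_ac)
  qed simp
  have n1: "norm (1::'a) > 0" by simp
  \<comment> \<open>The cap at 1 gives \<open>m ^ n \<le> m \<le> norm 1\<close>, which disposes of
    the factor \<open>norm 1\<close> for every positive n.\<close>
  define m where "m = min 1 (norm (1::'a))"
  have m: "0 < m" "m \<le> 1" "m \<le> norm (1::'a)" by (simp_all add: m_def)
  have "m / C \<le> rad"
  proof (rule rad_greatest)
    fix n :: nat assume n: "n > 0"
    have "m ^ n \<le> m" using m n by (metis power_decreasing power_one_right Suc_leI less_imp_le One_nat_def)
    then have "(m / C) ^ n \<le> norm (U ^ n)"
      using p[of n] m C(1) by (simp add: power_divide field_simps)
    then show "m / C \<le> root n (norm (U ^ n))"
      using m C(1) n by (metis divide_nonneg_nonneg less_imp_le real_root_le_iff real_root_power_cancel)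
  qed
  then show ?thesis using m C(1) by (meson divide_pos_pos less_le_trans)
qed

text \<open>A crude bound by iterating \<open>tail\<close>; it makes the suprema in
  \<open>fun_onorm\<close> range over bounded sets, so that they are true upper bounds.\<close>

lemma coeff_bounded: "\<exists>C>0. \<forall>n a x. x \<in> X \<longrightarrow> cmod (coeff n a x) \<le> C ^ n * norm a"
proof -
  obtain C where C: "C > 0" "\<And>a. norm (tail a) \<le> C * norm a" using tail_bounded by blast
  have "cmod (coeff n a x) \<le> C ^ n * norm a" if "x \<in> X" for n a x
  proof (induction n arbitrary: a)
    case (Suc n)
    have "cmod (coeff (Suc n) a x) \<le> C ^ n * norm (tail a)" using Suc by (simp add: coeff_Suc del: coeff_map.simps(2))
    also have "\<dots> \<le> C ^ n * (C * norm a)" using C by (intro mult_left_mono) auto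
    finally show ?case by (simp add: mult_ac)
  qed (simp add: E0_norm_le that)
  then show ?thesis using C(1) by blast
qed

definition cnorm :: "nat \<Rightarrow> real" where
  "cnorm n = fun_onorm X (coeff n)"

lemma coeff_le_cnorm:
  assumes x: "x \<in> X" shows "cmod (coeff n a x) \<le> cnorm n * norm a"
proof -
  obtain C where C: "C > 0" "\<And>n a x. x \<in> X \<Longrightarrow> cmod (coeff n a x) \<le> C ^ n * norm a"
    using coeff_bounded by blast
  have le: "cmod (coeff n b y) \<le> C ^ n" if "norm b \<le> 1" "y \<in> X" for b y
    using order_trans[OF C(2)[OF that(2)] mult_left_mono[OF that(1)]] C(1) by simp
  have 1: "cmod (coeff n b x) \<le> cnorm n" if b: "norm b \<le> 1" for b
  proof -
    have "cmod (coeff n b x) \<le> (SUP x\<in>X. cmod (coeff n b x))"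
      using le[OF b] x by (intro cSUP_upper bdd_aboveI2[where M="C ^ n"]) auto
    also have "\<dots> \<le> cnorm n"
      unfolding cnorm_def fun_onorm_def using b x le
      by (intro cSUP_upper[of b] bdd_aboveI2[where M="C ^ n"] cSUP_least) auto
    finally show ?thesis .
  qed
  show ?thesis
  proof (cases "a = 0")
    case True
    then show ?thesis using C(2)[OF x, of n a] by simp
  next
    case False
    have "norm (complex_of_real (1 / norm a) *\<^sub>C a) \<le> 1"
      using False by (simp add: norm_scaleC norm_divide)
    from 1[OF this] show ?thesis using False x
      by (simp add: coeff_scale norm_mult norm_divide field_simps)
  qed
qed

lemma cnorm_nonneg: "x \<in> X \<Longrightarrow> cnorm n \<ge> 0"
  using coeff_le_cnorm[of x n 1] norm_ge_zero[of "coeff n 1 x"]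
  by (metis order_trans zero_le_mult_iff norm_le_zero_iff zero_neq_one)

text \<open>The growth condition bounds \<open>cnorm n * norm (U ^ n)\<close> eventually by
  \<open>\<rho> ^ n\<close> for each \<open>\<rho> > 1\<close>, and \<open>norm (U ^ n)\<close> is
  at least \<open>rad ^ n\<close>. With \<open>\<rho>\<close> below \<open>rad / t\<close> a
  geometric series dominates.\<close>

lemma summable_cnorm:
  assumes x: "x \<in> X" and t: "0 \<le> t" "t < rad"
  shows "summable (\<lambda>n. cnorm n * t ^ n)"
proof -
  obtain \<rho> where \<rho>: "\<rho> > 1" "\<rho> * t / rad < 1"
  proof (cases "t = 0")
    case False
    then have "1 < rad / t" using t by simp
    then obtain r where "1 < r" "r < rad / t" using dense by blast
    then show thesis using that[of r] t False rad_pos by (simp add: field_simps)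
  qed (use that[of 2] in auto)
  have "limsup (\<lambda>n. ereal (root n (cnorm n * norm (U ^ n)))) < ereal \<rho>"
    unfolding cnorm_def by (rule le_less_trans[OF coeff_growth]) (use \<rho>(1) in simp)
  then have "\<forall>\<^sub>F n in sequentially. ereal (root n (cnorm n * norm (U ^ n))) < ereal \<rho>"
    by (rule Limsup_lessD)
  then have "\<forall>\<^sub>F n in sequentially. norm (cnorm n * t ^ n) \<le> (\<rho> * t / rad) ^ n"
    using eventually_gt_at_top[of 0]
  proof eventually_elim
    case (elim n)
    have c: "cnorm n \<ge> 0" using cnorm_nonneg[OF x] .
    have "root n (cnorm n * norm (U ^ n)) \<le> \<rho>" using elim(1) by simp
    then have "root n (cnorm n * norm (U ^ n)) ^ n \<le> \<rho> ^ n"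
      using c elim(2) by (intro power_mono real_root_ge_zero) auto
    then have "cnorm n * norm (U ^ n) \<le> \<rho> ^ n" using c elim(2) by simp
    moreover have "cnorm n * rad ^ n \<le> cnorm n * norm (U ^ n)"
      using rad_power_le[OF elim(2)] c by (rule mult_left_mono)
    ultimately have "cnorm n * rad ^ n \<le> \<rho> ^ n" by simp
    then have "cnorm n \<le> \<rho> ^ n / rad ^ n" using rad_pos by (simp add: field_simps)
    then have "cnorm n * t ^ n \<le> \<rho> ^ n / rad ^ n * t ^ n" using t by (intro mult_right_mono) auto
    then show ?case using c t by (simp add: power_mult_distrib power_divide)
  qed
  then show ?thesis
    using \<rho> t rad_pos
    by (intro summable_comparison_test_ev[OF _ summable_geometric[of "\<rho> * t / rad"]]) auto
qed

definition \<Theta> :: "'x \<Rightarrow> complex \<Rightarrow> 'a \<Rightarrow> complex" where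
  "\<Theta> x w a = (\<Sum>n. coeff n a x * w ^ n)"

lemma Theta_summable:
  assumes x: "x \<in> X" and w: "cmod w < rad"
  shows "summable (\<lambda>n. norm (coeff n a x * w ^ n))"
proof (rule summable_comparison_test')
  show "summable (\<lambda>n. norm a * (cnorm n * cmod w ^ n))"
    using summable_cnorm[OF x _ w] by (intro summable_mult) auto
  show "norm (norm (coeff n a x * w ^ n)) \<le> norm a * (cnorm n * cmod w ^ n)" for n
    using mult_right_mono[OF coeff_le_cnorm[OF x, of n a], of "cmod w ^ n"]
    by (simp add: norm_mult norm_power mult_ac)
qed

lemma Theta_sums:
  "x \<in> X \<Longrightarrow> cmod w < rad \<Longrightarrow> (\<lambda>n. coeff n a x * w ^ n) sums \<Theta> x w a"
  unfolding \<Theta>_def by (rule summable_sums[OF summable_norm_cancel[OF Theta_summable]])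

lemma Theta_0: "\<Theta> x 0 a = E\<^sub>0 a x"
  unfolding \<Theta>_def by (subst powser_zero) simp

lemma Theta_iota:
  assumes x: "x \<in> X" and f: "f \<in> cont_fun X" and w: "cmod w < rad" shows "\<Theta> x w (\<iota> f) = f x"
proof -
  have "coeff n 0 x = 0" for n using coeff_scale[OF x, of n 0 0] by simp
  then have "coeff n (\<iota> f) x = (if n = 0 then f x else 0)" for n
    using x f by (cases n) (simp_all add: E0_iota coeff_Suc tail_iota del: coeff_map.simps(2))
  then have "(\<lambda>n. coeff n (\<iota> f) x * w ^ n) = (\<lambda>n. if n = 0 then f x else 0)" by auto
  then show ?thesis using Theta_sums[OF x w, of "\<iota> f"] sums_single[of 0 "\<lambda>_. f x"]
    by (simp add: sums_unique2)
qed

lemma Theta_U: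
  assumes x: "x \<in> X" and w: "cmod w < rad" shows "\<Theta> x w U = w"
proof -
  have z: "coeff n 0 x = 0" for n using coeff_scale[OF x, of n 0 0] by simp
  have t: "tail U = 1" "tail 1 = 0" using tail_mult_U[of 1] tail_iota[of "\<lambda>x. 1"] by (simp_all add: iota_one)
  have "coeff n U x = (if n = 1 then 1 else 0)" for n
  proof (cases n)
    case (Suc m)
    then show ?thesis using x z E0_character[OF x]
      by (cases m) (simp_all add: coeff_Suc t character_on_def del: coeff_map.simps(2))
  qed (use x in \<open>simp add: E0_U\<close>)
  then have "(\<lambda>n. coeff n U x * w ^ n) = (\<lambda>n. if n = 1 then w else 0)" by auto
  then show ?thesis using Theta_sums[OF x w, of U] sums_single[of 1 "\<lambda>_. w"]
    by (simp add: sums_unique2)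
qed

text \<open>Multiplicativity is the Cauchy product of two absolutely convergent series; that
  \<open>x\<close> is fixed enters through \<open>coeff_mult_fixed\<close>.\<close>

lemma Theta_character:
  assumes x: "x \<in> X" "\<eta> x = x" and w: "cmod w < rad"
  shows "character_on UNIV (\<Theta> x w)"
  unfolding character_on_def
proof (intro conjI ballI allI)
  fix a b c
  note S = Theta_sums[OF x(1) w]
  have "(\<lambda>n. coeff n (a + b) x * w ^ n) sums (\<Theta> x w a + \<Theta> x w b)"
    using sums_add[OF S[of a] S[of b]] x(1) by (simp add: coeff_add distrib_right)
  then show "\<Theta> x w (a + b) = \<Theta> x w a + \<Theta> x w b" by (rule sums_unique2[OF S])
  have "(\<lambda>n. coeff n (c *\<^sub>C a) x * w ^ n) sums (c * \<Theta> x w a)"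
    using sums_mult[OF S[of a], of c] x(1) by (simp add: coeff_scale mult.assoc)
  then show "\<Theta> x w (c *\<^sub>C a) = c * \<Theta> x w a" by (rule sums_unique2[OF S])
  have "(\<lambda>k. \<Sum>i\<le>k. coeff i a x * w ^ i * (coeff (k - i) b x * w ^ (k - i))) sums (\<Theta> x w a * \<Theta> x w b)"
    unfolding \<Theta>_def by (rule Cauchy_product_sums[OF Theta_summable[OF x(1) w] Theta_summable[OF x(1) w]])
  moreover have "(\<Sum>i\<le>k. coeff i a x * w ^ i * (coeff (k - i) b x * w ^ (k - i))) = coeff k (a * b) x * w ^ k" for k
  proof -
    have "(\<Sum>i\<le>k. coeff i a x * w ^ i * (coeff (k - i) b x * w ^ (k - i))) =
      (\<Sum>i\<le>k. coeff i a x * coeff (k - i) b x * w ^ k)"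
    proof (rule sum.cong)
      fix i assume "i \<in> {..k}"
      then have "w ^ k = w ^ i * w ^ (k - i)" by (simp flip: power_add)
      then show "coeff i a x * w ^ i * (coeff (k - i) b x * w ^ (k - i)) = coeff i a x * coeff (k - i) b x * w ^ k"
        by (simp add: mult_ac)
    qed simp
    then show ?thesis using coeff_mult_fixed[OF x] by (simp add: sum_distrib_right)
  qed
  ultimately have "(\<lambda>n. coeff n (a * b) x * w ^ n) sums (\<Theta> x w a * \<Theta> x w b)" by simp
  then show "\<Theta> x w (a * b) = \<Theta> x w a * \<Theta> x w b" by (rule sums_unique2[OF S])
next
  show "\<Theta> x w 1 = 1" using Theta_iota[OF x(1) cont_fun_const w, of 1] by (simp add: iota_one)
qed

end

section \<open>The subalgebra with analytic coefficients\<close>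

lemma closed_cauchy_domainE:
  assumes "K \<in> closed_cauchy_domains"
  shows "open (interior K)" "connected (interior K)" "interior K \<noteq> {}" "closure (interior K) = K"
proof -
  obtain G where G: "bounded_cauchy_domain G" "K = closure G"
    using assms unfolding closed_cauchy_domains_def by blast
  then show "open (interior K)" "connected (interior K)" "interior K \<noteq> {}" "closure (interior K) = K"
    using interior_closure_cauchy_domain[OF G(1)] unfolding bounded_cauchy_domain_def by auto
qed

lemma analytic_fun_uniform_limit:
  assumes f: "\<And>n::nat. f n \<in> analytic_fun K" and lim: "uniform_limit K f g sequentially"
  shows "g \<in> analytic_fun K"
proof -
  have "continuous_on K g"
    using f by (intro uniform_limit_theorem[OF _ lim]) (auto simp: analytic_fun_iff)
  moreover have "g holomorphic_on interior K"
  proof (rule holomorphic_uniform_sequence)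
    show "f n holomorphic_on interior K" for n using f by (simp add: analytic_fun_iff)
    fix x assume "x \<in> interior K"
    then obtain d where d: "d > 0" "cball x d \<subseteq> interior K"
      using open_contains_cball[of "interior K"] by blast
    then have "cball x d \<subseteq> K" using interior_subset by blast
    then show "\<exists>d>0. cball x d \<subseteq> interior K \<and> uniform_limit (cball x d) f g sequentially"
      using d uniform_limit_on_subset[OF lim] by blast
  qed simp
  ultimately show ?thesis by (simp add: analytic_fun_iff)
qed

lemma analytic_fun_maps_interior:
  assumes K: "connected (interior K)" and f: "f \<in> analytic_fun K" and nc: "\<not> f constant_on interior K"
    and im: "f ` interior K \<subseteq> S"
  shows "f ` interior K \<subseteq> interior S"
proof -
  have "open (f ` interior K)"
    using f by (intro open_mapping_thm[of f "interior K"] K nc) (auto simp: analytic_fun_iff)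
  then show ?thesis using im by (simp add: interior_maximal)
qed

text \<open>A constant \<open>f\<close> is treated apart because its value may be a boundary point
  of \<open>S\<close>, where \<open>g\<close> is only continuous; otherwise the open mapping theorem
  keeps the image of the interior in the interior.\<close>

lemma analytic_fun_compose:
  assumes K: "connected (interior K)" and f: "f \<in> analytic_fun K" "f ` K \<subseteq> S" and g: "g \<in> analytic_fun S"
  shows "g \<circ> f \<in> analytic_fun K"
proof -
  have "continuous_on K (g \<circ> f)"
    using f g by (intro continuous_on_compose) (auto simp: analytic_fun_iff intro: continuous_on_subset)
  moreover have "g \<circ> f holomorphic_on interior K"
  proof (cases "f constant_on interior K")
    case True
    then obtain c where "\<And>z. z \<in> interior K \<Longrightarrow> f z = c" unfolding constant_on_def by blast
    then show ?thesis by (subst holomorphic_cong[of _ "interior K" _ "\<lambda>_. g c"]) auto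
  next
    case False
    then have "f ` interior K \<subseteq> interior S"
      using analytic_fun_maps_interior[OF K f(1)] f(2) interior_subset by blast
    then show ?thesis using f g
      by (intro holomorphic_on_compose_gen[of f "interior K" g "interior S"]) (auto simp: analytic_fun_iff)
  qed
  ultimately show ?thesis by (simp add: analytic_fun_iff)
qed

locale analytic_conjugacy_algebra =
  topological_conjugacy_algebra K \<eta> \<iota> U E\<^sub>0
  for K :: "complex set" and \<eta> :: "complex \<Rightarrow> complex"
    and \<iota> :: "(complex \<Rightarrow> complex) \<Rightarrow> 'a::complex_banach_algebra_1" and U E\<^sub>0 +
  assumes K_cauchy: "K \<in> closed_cauchy_domains"
    and eta_analytic: "\<eta> \<in> analytic_fun K"
begin

lemmas K_props = closed_cauchy_domainE[OF K_cauchy]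

definition B :: "'a set" where
  "B = conj_subalgebra \<iota> U (analytic_fun K)"

lemma K_nonempty: "K \<noteq> {}"
  using K_props(3) interior_subset by blast

lemma analytic_cont: "f \<in> analytic_fun K \<Longrightarrow> f \<in> cont_fun K"
  by (simp add: analytic_fun_iff cont_fun_def)

lemma B_subalgebra: "complex_subalgebra B" and B_closed: "closed B"
proof -
  have "complex_subalgebra B \<and> closed B"
    unfolding B_def conj_subalgebra_def
    by (rule hull_in) (auto simp: complex_subalgebra_def)
  then show "complex_subalgebra B" "closed B" by auto
qed

lemma B_zero: "0 \<in> B" and B_add: "a \<in> B \<Longrightarrow> b \<in> B \<Longrightarrow> a + b \<in> B"
  and B_mult: "a \<in> B \<Longrightarrow> b \<in> B \<Longrightarrow> a * b \<in> B" and B_scale: "a \<in> B \<Longrightarrow> c *\<^sub>C a \<in> B"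
  using B_subalgebra unfolding complex_subalgebra_def by auto

lemma monomial_in_B:
  assumes "f \<in> analytic_fun K" shows "\<iota> f * U ^ n \<in> B"
proof -
  define g where "g k = (if k = n then f else (\<lambda>x. 0))" for k
  have "(\<Sum>k<Suc n. \<iota> (g k) * U ^ k) = \<iota> f * U ^ n"
    by (subst sum.lessThan_Suc) (simp add: g_def iota_zero)
  then have "\<iota> f * U ^ n \<in> skew_polys \<iota> U (analytic_fun K)"
    using assms unfolding skew_polys_def
    by (intro CollectI exI[of _ g] exI[of _ "Suc n"]) (simp add: g_def)
  then show ?thesis unfolding B_def conj_subalgebra_def by (rule hull_inc)
qed

lemma iota_in_B: "f \<in> analytic_fun K \<Longrightarrow> \<iota> f \<in> B"
  using monomial_in_B[of f 0] by simp

lemma U_in_B: "U \<in> B"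
  using monomial_in_B[of "\<lambda>x. 1" 1] by (simp add: iota_one)

lemma one_in_B: "1 \<in> B"
  using iota_in_B[of "\<lambda>x. 1"] by (simp add: iota_one)

text \<open>The elements of \<open>B\<close> with the property form a closed subalgebra containing
  all polynomials, and \<open>B\<close> is the least such subalgebra.\<close>

lemma B_induct [consumes 1, case_names iota U add mult scale limit]:
  assumes a: "a \<in> B"
    and iota: "\<And>f. f \<in> analytic_fun K \<Longrightarrow> P (\<iota> f)" and PU: "P U"
    and add: "\<And>a b. a \<in> B \<Longrightarrow> b \<in> B \<Longrightarrow> P a \<Longrightarrow> P b \<Longrightarrow> P (a + b)"
    and mult: "\<And>a b. a \<in> B \<Longrightarrow> b \<in> B \<Longrightarrow> P a \<Longrightarrow> P b \<Longrightarrow> P (a * b)"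
    and scale: "\<And>c a. a \<in> B \<Longrightarrow> P a \<Longrightarrow> P (c *\<^sub>C a)"
    and lim: "\<And>s a. (\<And>n. s n \<in> B) \<Longrightarrow> (\<And>n. P (s n)) \<Longrightarrow> s \<longlonglongrightarrow> a \<Longrightarrow> a \<in> B \<Longrightarrow> P a"
  shows "P a"
proof -
  let ?Q = "{a \<in> B. P a}"
  have P0: "P 0" using iota[of "\<lambda>x. 0"] by (simp add: iota_zero)
  have "complex_subalgebra ?Q"
    unfolding complex_subalgebra_def using P0 add mult scale B_zero B_add B_mult B_scale by auto
  moreover have "closed ?Q"
    unfolding closed_sequential_limits
  proof (intro allI impI)
    fix s l assume s: "(\<forall>n. s n \<in> ?Q) \<and> s \<longlonglongrightarrow> l"
    then have "l \<in> B" using closed_sequentially[OF B_closed, of s l] by simp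
    then show "l \<in> ?Q" using s lim[of s l] by simp
  qed
  moreover have "skew_polys \<iota> U (analytic_fun K) \<subseteq> ?Q"
  proof
    fix b assume "b \<in> skew_polys \<iota> U (analytic_fun K)"
    then obtain f N where b: "b = (\<Sum>n<N. \<iota> (f n) * U ^ n)" and f: "\<And>n. f n \<in> analytic_fun K"
      unfolding skew_polys_def by blast
    have pw: "U ^ n \<in> ?Q" for n
      using iota[of "\<lambda>x. 1"] one_in_B by (induction n) (auto simp: iota_one U_in_B PU B_mult mult)
    have "\<iota> (f n) * U ^ n \<in> ?Q" for n
      using pw[of n] iota[OF f] iota_in_B[OF f] by (auto intro: B_mult mult)
    then have "(\<Sum>n<N. \<iota> (f n) * U ^ n) \<in> ?Q"
      by (induction N) (use P0 in \<open>auto simp: B_zero intro: B_add add\<close>)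
    then show "b \<in> ?Q" by (simp add: b)
  qed
  ultimately have "B \<subseteq> ?Q"
    unfolding B_def conj_subalgebra_def by (intro hull_minimal) auto
  then show ?thesis using a by blast
qed

lemma eta_compose: "f \<in> analytic_fun K \<Longrightarrow> f \<circ> \<eta> \<in> analytic_fun K"
  by (rule analytic_fun_compose[OF K_props(2) eta_analytic eta_into])

text \<open>The two parts are proved together because the product rule for \<open>tail\<close>
  involves \<open>E\<^sub>0\<close> of both factors, the second composed with \<open>\<eta>\<close>.
  Limits pass because \<open>E\<^sub>0\<close> is contractive and \<open>tail\<close> is
  bounded.\<close>

lemma E0_tail_in: "a \<in> B \<Longrightarrow> E\<^sub>0 a \<in> analytic_fun K \<and> tail a \<in> B"
proof (induction rule: B_induct)
  case (iota f)
  then have "E\<^sub>0 (\<iota> f) \<in> analytic_fun K"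
    by (rule analytic_fun_cong) (rule E0_iota[OF analytic_cont[OF iota]])
  then show ?case using iota by (simp add: tail_iota analytic_cont B_zero)
next
  case U
  have "E\<^sub>0 U \<in> analytic_fun K" by (rule analytic_fun_cong[of "\<lambda>x. 0"]) (auto simp: E0_U)
  then show ?case using tail_mult_U[of 1] one_in_B by simp
next
  case (add a b)
  have "E\<^sub>0 (a + b) \<in> analytic_fun K"
    by (rule analytic_fun_cong[OF analytic_fun_add[of "E\<^sub>0 a" K "E\<^sub>0 b"]]) (use add in \<open>auto simp: E0_add\<close>)
  then show ?case using add by (simp add: tail_add B_add)
next
  case (mult a b)
  have "E\<^sub>0 (a * b) \<in> analytic_fun K"
    by (rule analytic_fun_cong[OF analytic_fun_mult[of "E\<^sub>0 a" K "E\<^sub>0 b"]]) (use mult in \<open>auto simp: E0_mult\<close>)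
  moreover have "shift b \<in> B"
    unfolding shift_def using mult by (intro B_add iota_in_B eta_compose B_mult U_in_B) auto
  ultimately show ?case using mult by (auto simp: tail_mult intro!: B_add B_mult iota_in_B)
next
  case (scale c a)
  have "E\<^sub>0 (c *\<^sub>C a) \<in> analytic_fun K"
    by (rule analytic_fun_cong[OF analytic_fun_mult[of "\<lambda>x. c" K "E\<^sub>0 a"]]) (use scale in \<open>auto simp: E0_scale\<close>)
  then show ?case using scale by (simp add: tail_scale B_scale)
next
  case (limit s a)
  have "uniform_limit K (\<lambda>n. E\<^sub>0 (s n)) (E\<^sub>0 a) sequentially"
    unfolding uniform_limit_iff
  proof (intro allI impI)
    fix e :: real assume "e > 0"
    then have "\<forall>\<^sub>F n in sequentially. dist (s n) a < e" using limit by (simp add: tendsto_iff)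
    then show "\<forall>\<^sub>F n in sequentially. \<forall>x\<in>K. dist (E\<^sub>0 (s n) x) (E\<^sub>0 a x) < e"
    proof eventually_elim
      case (elim n)
      then show ?case using E0_norm_le[of _ "s n - a"] by (auto simp: dist_norm E0_diff intro: le_less_trans)
    qed
  qed
  then have 1: "E\<^sub>0 a \<in> analytic_fun K"
    by (rule analytic_fun_uniform_limit[rotated]) (use limit.IH in blast)
  obtain C where C: "C > 0" "\<And>a. norm (tail a) \<le> C * norm a" using tail_bounded by blast
  have td: "tail (s n) - tail a = tail (s n - a)" for n
    using tail_add[of "s n - a" a] by simp
  have "(\<lambda>n. s n - a) \<longlonglongrightarrow> 0" using limit by (simp add: LIM_zero_iff)
  then have "(\<lambda>n. C * norm (s n - a)) \<longlonglongrightarrow> C * 0" by (intro tendsto_mult_left tendsto_norm_zero)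
  then have "(\<lambda>n. tail (s n) - tail a) \<longlonglongrightarrow> 0"
    unfolding td mult_zero_right by (rule Lim_null_comparison[rotated]) (simp add: C(2))
  then have "(\<lambda>n. tail (s n)) \<longlonglongrightarrow> tail a" by (simp add: LIM_zero_iff)
  then have "tail a \<in> B"
    by (rule closed_sequentially[OF B_closed, rotated]) (use limit.IH in blast)
  with 1 show ?case by simp
qed

lemma E0_analytic: "a \<in> B \<Longrightarrow> E\<^sub>0 a \<in> analytic_fun K" and tail_in_B: "a \<in> B \<Longrightarrow> tail a \<in> B"
  using E0_tail_in by auto

lemma coeff_analytic: "a \<in> B \<Longrightarrow> coeff n a \<in> analytic_fun K"
  by (induction n arbitrary: a) (simp_all add: E0_analytic coeff_Suc tail_in_B del: coeff_map.simps(2))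

section \<open>Characters of the subalgebra\<close>

lemma character_eval:
  assumes \<theta>: "character_on B \<theta>"
  shows "\<theta> (\<iota> (\<lambda>z. z)) \<in> K" "f \<in> analytic_fun K \<Longrightarrow> \<theta> (\<iota> f) = f (\<theta> (\<iota> (\<lambda>z. z)))"
proof -
  interpret analytic_fun_character K "\<lambda>f. \<theta> (\<iota> f)"
  proof
    fix f g c assume f: "f \<in> analytic_fun K"
    { assume g: "g \<in> analytic_fun K"
      show "\<theta> (\<iota> (\<lambda>z. f z + g z)) = \<theta> (\<iota> f) + \<theta> (\<iota> g)" "\<theta> (\<iota> (\<lambda>z. f z * g z)) = \<theta> (\<iota> f) * \<theta> (\<iota> g)"
        using \<theta> f g iota_in_B unfolding character_on_def by (auto simp: iota_add iota_mult analytic_cont) }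
    show "\<theta> (\<iota> (\<lambda>z. c * f z)) = c * \<theta> (\<iota> f)"
      using \<theta> f iota_in_B unfolding character_on_def by (auto simp: iota_scale analytic_cont)
    assume "\<And>z. z \<in> K \<Longrightarrow> g z = f z"
    then have "\<iota> g = \<iota> f"
      using f by (intro iota_cong) (auto intro!: analytic_cont analytic_fun_cong[OF f])
    then show "\<theta> (\<iota> g) = \<theta> (\<iota> f)" by simp
  next
    show "\<theta> (\<iota> (\<lambda>z. 1)) = 1" using \<theta> unfolding iota_one character_on_def by simp
  qed
  show "\<theta> (\<iota> (\<lambda>z. z)) \<in> K" by (rule ident_in)
  show "f \<in> analytic_fun K \<Longrightarrow> \<theta> (\<iota> f) = f (\<theta> (\<iota> (\<lambda>z. z)))" by (rule eval[OF K_cauchy])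
qed

lemma character_norm_le: "character_on B \<theta> \<Longrightarrow> a \<in> B \<Longrightarrow> cmod (\<theta> a) \<le> norm a"
  by (rule character_on_norm_le[OF B_subalgebra B_closed])

lemma character_diff: "character_on B \<theta> \<Longrightarrow> a \<in> B \<Longrightarrow> b \<in> B \<Longrightarrow> \<theta> (a - b) = \<theta> a - \<theta> b"
  by (rule character_on_diff[OF B_subalgebra])

lemma character_U_le:
  assumes \<theta>: "character_on B \<theta>" shows "cmod (\<theta> U) \<le> rad"
proof (rule rad_greatest)
  fix n :: nat assume n: "n > 0"
  have "U ^ n \<in> B \<and> \<theta> (U ^ n) = \<theta> U ^ n" for n
    using \<theta> U_in_B one_in_B B_mult unfolding character_on_def by (induction n) auto
  then have "cmod (\<theta> U) ^ n \<le> norm (U ^ n)"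
    using character_norm_le[OF \<theta>, of "U ^ n"] by (simp add: norm_power)
  then show "cmod (\<theta> U) \<le> root n (norm (U ^ n))"
    using n by (metis norm_ge_zero real_root_le_iff real_root_power_cancel)
qed

lemma character_covariant:
  assumes \<theta>: "character_on B \<theta>"
  shows "\<theta> U = 0 \<or> \<eta> (\<theta> (\<iota> (\<lambda>z. z))) = \<theta> (\<iota> (\<lambda>z. z))"
proof -
  have "U * \<iota> (\<lambda>z. z) = \<iota> \<eta> * U"
    using covariant[OF analytic_cont[OF analytic_fun_ident]] by (simp add: o_def)
  moreover have "\<theta> (U * \<iota> (\<lambda>z. z)) = \<theta> U * \<theta> (\<iota> (\<lambda>z. z))" "\<theta> (\<iota> \<eta> * U) = \<theta> (\<iota> \<eta>) * \<theta> U"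
    using \<theta> U_in_B iota_in_B eta_analytic analytic_fun_ident unfolding character_on_def by blast+
  ultimately show ?thesis using character_eval(2)[OF \<theta> eta_analytic] by auto
qed

text \<open>Characters are contractive, hence continuous on \<open>B\<close>, and the generators
  decide. All later identifications of characters consist in comparing these two
  coordinates.\<close>

lemma character_eqI:
  assumes \<theta>: "character_on B \<theta>" "character_on B \<theta>'"
    and eq: "\<theta> (\<iota> (\<lambda>z. z)) = \<theta>' (\<iota> (\<lambda>z. z))" "\<theta> U = \<theta>' U" and a: "a \<in> B"
  shows "\<theta> a = \<theta>' a"
  using a
proof (induction rule: B_induct)
  case (iota f)
  then show ?case using character_eval(2) \<theta> eq by metis
next
  case (limit s a)
  have lim: "(\<lambda>n. \<phi> (s n)) \<longlonglongrightarrow> \<phi> a" if \<phi>: "character_on B \<phi>" for \<phi>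
  proof (rule LIM_zero_cancel, rule Lim_null_comparison[OF always_eventually], intro allI)
    show "norm (\<phi> (s n) - \<phi> a) \<le> norm (s n - a)" for n
      using character_norm_le[OF \<phi>, of "s n - a"] complex_subalgebra_diff[OF B_subalgebra] limit.hyps
      by (simp add: character_diff[OF \<phi>])
    show "(\<lambda>n. norm (s n - a)) \<longlonglongrightarrow> 0"
      using limit.hyps(2) by (simp add: LIM_zero_iff tendsto_norm_zero)
  qed
  show ?case using lim[OF \<theta>(1)] lim[OF \<theta>(2)] limit.IH by (simp add: LIMSEQ_unique)
qed (use \<theta> eq in \<open>simp_all add: character_on_def\<close>)

lemma character_on_subset: "character_on UNIV \<theta> \<Longrightarrow> character_on B \<theta>"
  by (simp add: character_on_def)

lemma E0_char: "x \<in> K \<Longrightarrow> character_on B (\<lambda>a. E\<^sub>0 a x)"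
  by (intro character_on_subset E0_character)

lemma Theta_char: "x \<in> K \<Longrightarrow> \<eta> x = x \<Longrightarrow> cmod w < rad \<Longrightarrow> character_on B (\<Theta> x w)"
  by (intro character_on_subset Theta_character)

lemma Theta_ident: "x \<in> K \<Longrightarrow> cmod w < rad \<Longrightarrow> \<Theta> x w (\<iota> (\<lambda>z. z)) = x"
  by (simp add: Theta_iota analytic_cont)

lemma Theta_holomorphic: "x \<in> K \<Longrightarrow> (\<lambda>w. \<Theta> x w a) holomorphic_on ball 0 rad"
  using Theta_sums[of x _ a] by (intro power_series_holomorphic[where z=0 and a="\<lambda>n. coeff n a x"]) auto

text \<open>Uniformity in both variables at once gives the joint continuity of
  \<open>\<Theta>\<close> as well as its analyticity in the base point.\<close>

lemma Theta_uniform: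
  assumes t: "0 \<le> t" "t < rad"
  shows "uniform_limit (K \<times> cball 0 t) (\<lambda>n y. \<Sum>i<n. coeff i a (fst y) * snd y ^ i)
    (\<lambda>y. \<Theta> (fst y) (snd y) a) sequentially"
  unfolding \<Theta>_def
proof (rule Weierstrass_m_test)
  obtain x where x: "x \<in> K" using K_nonempty by blast
  show "summable (\<lambda>n. norm a * (cnorm n * t ^ n))"
    using summable_cnorm[OF x t] by (intro summable_mult)
  fix n and y :: "complex \<times> complex" assume y: "y \<in> K \<times> cball 0 t"
  have "cmod (coeff n a (fst y)) * cmod (snd y) ^ n \<le> (cnorm n * norm a) * t ^ n"
    using y coeff_le_cnorm cnorm_nonneg[OF x] t by (intro mult_mono power_mono) auto
  then show "norm (coeff n a (fst y) * snd y ^ n) \<le> norm a * (cnorm n * t ^ n)"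
    by (simp add: norm_mult norm_power mult_ac)
qed

lemma Theta_continuous: "continuous_on (K \<times> ball 0 rad) (\<lambda>y. \<Theta> (fst y) (snd y) a)"
proof -
  have c: "continuous_on (K \<times> cball 0 t) (\<lambda>y. \<Theta> (fst y) (snd y) a)" if t: "0 \<le> t" "t < rad" for t
  proof (rule uniform_limit_theorem[OF _ Theta_uniform[OF t]])
    have "continuous_on (K \<times> cball 0 t) (\<lambda>y. coeff i a (fst y))" for i
      using coeff_cont[of i a] unfolding cont_fun_def
      by (auto intro!: continuous_on_compose2[of K "coeff i a" _ fst] continuous_on_fst continuous_on_id)
    then show "\<forall>\<^sub>F n in sequentially.
        continuous_on (K \<times> cball 0 t) (\<lambda>y. \<Sum>i<n. coeff i a (fst y) * snd y ^ i)"
      by (intro always_eventually allI continuous_intros) auto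
  qed simp
  show ?thesis
    unfolding continuous_on_eq_continuous_within
  proof
    fix y :: "complex \<times> complex" assume y: "y \<in> K \<times> ball 0 rad"
    then obtain t where t: "cmod (snd y) < t" "t < rad" using dense by (auto simp: mem_Times_iff)
    then have t0: "0 \<le> t" using norm_ge_zero[of "snd y"] by linarith
    have "continuous_on (K \<times> ball 0 t) (\<lambda>y. \<Theta> (fst y) (snd y) a)"
      by (rule continuous_on_subset[OF c[OF t0 t(2)]]) auto
    then have "continuous (at y within K \<times> ball 0 t) (\<lambda>y. \<Theta> (fst y) (snd y) a)"
      using y t(1) unfolding continuous_on_eq_continuous_within by (metis mem_Times_iff mem_ball_0)
    moreover have "at y within K \<times> ball 0 t = at y within K \<times> ball 0 rad"
      using t y by (intro at_within_nhd[of _ "UNIV \<times> ball 0 t"]) (auto simp: mem_Times_iff intro: open_Times)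
    ultimately show "continuous (at y within K \<times> ball 0 rad) (\<lambda>y. \<Theta> (fst y) (snd y) a)"
      by (simp add: continuous_within)
  qed
qed

lemma Theta_analytic:
  assumes a: "a \<in> B" and w: "cmod w < rad" shows "(\<lambda>x. \<Theta> x w a) \<in> analytic_fun K"
proof (rule analytic_fun_uniform_limit)
  show "(\<lambda>x. \<Sum>i<n. coeff i a x * w ^ i) \<in> analytic_fun K" for n
    using coeff_analytic[OF a] by (induction n) (auto intro!: analytic_fun_add analytic_fun_mult)
  show "uniform_limit K (\<lambda>n x. \<Sum>i<n. coeff i a x * w ^ i) (\<lambda>x. \<Theta> x w a) sequentially"
    using Theta_uniform[of "cmod w" a] w unfolding uniform_limit_iff
    by (auto elim!: eventually_mono)
qed

text \<open>This spares a description of the characters with \<open>|\<theta> U| = rad\<close>.\<close>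
lemma character_limit_Theta:
  assumes id: "\<And>x. x \<in> K \<Longrightarrow> \<eta> x = x" and \<theta>: "character_on B \<theta>" and a: "a \<in> B"
  obtains u where "\<And>n. cmod (u n) < rad" "(\<lambda>n. \<Theta> (\<theta> (\<iota> (\<lambda>z. z))) (u n) a) \<longlonglongrightarrow> \<theta> a"
proof -
  define x where "x = \<theta> (\<iota> (\<lambda>z. z))"
  have x: "x \<in> K" using character_eval(1)[OF \<theta>] by (simp add: x_def)
  \<comment> \<open>Shrinking by n / (n + 1) moves \<open>\<theta> U\<close> into the open disc,
    even if it lies on the circle.\<close>
  define u where "u n = of_real (real n / real (Suc n)) * \<theta> U" for n
  have u: "cmod (u n) < rad" for n
  proof (cases "\<theta> U = 0")
    case False
    have "cmod (u n) = real n / real (Suc n) * cmod (\<theta> U)"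
      by (simp add: u_def norm_mult norm_divide del: of_nat_Suc)
    also have "\<dots> < 1 * cmod (\<theta> U)" using False by (intro mult_strict_right_mono) auto
    finally show ?thesis using character_U_le[OF \<theta>] by simp
  qed (simp add: u_def rad_pos)
  have uc: "character_on B (\<Theta> x (u n))" for n by (rule Theta_char[OF x id[OF x] u])
  have "(\<lambda>n. complex_of_real (real n / real (Suc n)) * \<theta> U) \<longlonglongrightarrow> of_real 1 * \<theta> U"
    by (intro tendsto_intros LIMSEQ_n_over_Suc_n)
  moreover have "u = (\<lambda>n. complex_of_real (real n / real (Suc n)) * \<theta> U)"
    by (rule ext) (rule u_def)
  ultimately have uU: "u \<longlonglongrightarrow> \<theta> U" by simp
  have "(\<lambda>n. \<Theta> x (u n) a) \<longlonglongrightarrow> \<theta> a"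
    using a
  proof (induction rule: B_induct)
    case (iota f)
    then show ?case using character_eval(2)[OF \<theta> iota, folded x_def] by (simp add: Theta_iota[OF x _ u] analytic_cont)
  next
    case U
    then show ?case using uU by (simp add: Theta_U[OF x u])
  next
    case (limit s a)
    show ?case
      unfolding LIMSEQ_iff
    proof (intro allI impI)
      fix e :: real assume e: "e > 0"
      obtain k where k: "norm (s k - a) < e / 3"
        using limit.hyps(2) e unfolding LIMSEQ_iff by (metis divide_pos_pos order_refl zero_less_numeral)
      obtain N where N: "\<And>n. n \<ge> N \<Longrightarrow> norm (\<Theta> x (u n) (s k) - \<theta> (s k)) < e / 3"
        using limit.IH[of k] e unfolding LIMSEQ_iff by (metis divide_pos_pos zero_less_numeral)
      have sB: "s k - a \<in> B" using complex_subalgebra_diff[OF B_subalgebra] limit by simp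
      \<comment> \<open>All \<open>\<Theta> x (u n)\<close> are contractive, so this estimate is
        uniform in n and convergence at \<open>s k\<close> passes to \<open>a\<close>.\<close>
      have le: "norm (\<phi> (s k) - \<phi> a) < e / 3" if \<phi>: "character_on B \<phi>" for \<phi>
        using character_norm_le[OF \<phi> sB] character_diff[OF \<phi> limit.hyps(1,3)] k by simp
      have "norm (\<Theta> x (u n) a - \<theta> a) < e" if "n \<ge> N" for n
        using N[OF that] le[OF uc, of n] le[OF \<theta>]
          norm_triangle_ineq[of "\<Theta> x (u n) (s k) - \<theta> (s k)" "\<theta> (s k) - \<theta> a"]
          norm_triangle_ineq4[of "\<Theta> x (u n) (s k) - \<theta> a" "\<Theta> x (u n) (s k) - \<Theta> x (u n) a"]
        by simp
      then show "\<exists>N. \<forall>n\<ge>N. norm (\<Theta> x (u n) a - \<theta> a) < e" by blast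
    qed
  qed (use uc \<theta> in \<open>auto simp: character_on_def intro!: tendsto_intros\<close>)
  then show thesis using that[of u] u unfolding x_def by simp
qed

text \<open>Expresses \<open>\<eta> = id\<close> through the algebra alone, so that an isomorphism
  preserves it. One direction cancels \<open>U\<close> in the covariance relation; in the other,
  every element is shown to commute with the functions, then with \<open>U\<close>, then with all of
  \<open>B\<close>.\<close>

lemma commutative_iff_eta:
  "(\<forall>a\<in>B. \<forall>b\<in>B. a * b = b * a) \<longleftrightarrow> (\<forall>x\<in>K. \<eta> x = x)"
proof
  assume "\<forall>a\<in>B. \<forall>b\<in>B. a * b = b * a"
  then have "U * \<iota> (\<lambda>z. z) = \<iota> (\<lambda>z. z) * U" using U_in_B iota_in_B analytic_fun_ident by blast
  moreover have "U * \<iota> (\<lambda>z. z) = \<iota> \<eta> * U"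
    using covariant[OF analytic_cont[OF analytic_fun_ident]] by (simp add: o_def)
  ultimately have "\<iota> \<eta> = \<iota> (\<lambda>z. z)" using tail_mult_U by metis
  then show "\<forall>x\<in>K. \<eta> x = x"
    using E0_iota[OF analytic_cont] eta_analytic analytic_fun_ident by metis
next
  assume id: "\<forall>x\<in>K. \<eta> x = x"
  have com: "a * \<iota> f = \<iota> f * a" if "a \<in> B" "f \<in> analytic_fun K" for a f
    using that(1)
  proof (induction rule: B_induct)
    case (iota g)
    then show ?case using that(2) iota_mult[of f g] iota_mult[of g f] by (simp add: analytic_cont mult.commute)
  next
    case U
    have "\<iota> (f \<circ> \<eta>) = \<iota> f" using id that(2) by (intro iota_cong cont_fun_eta) (auto simp: analytic_cont)
    then show ?case using covariant[OF analytic_cont[OF that(2)]] by simp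
  next
    case (limit s a)
    have "(\<lambda>n. s n * \<iota> f) \<longlonglongrightarrow> a * \<iota> f" "(\<lambda>n. \<iota> f * s n) \<longlonglongrightarrow> \<iota> f * a"
      using limit.hyps(2) by (intro tendsto_intros; simp)+
    then show ?case using limit.IH LIMSEQ_unique by auto
  qed (simp_all add: distrib_left distrib_right scaleC_mult_left scaleC_mult_right, metis mult.assoc)
  have comU: "a * U = U * a" if "a \<in> B" for a
    using that
  proof (induction rule: B_induct)
    case (iota f)
    then show ?case using com[OF U_in_B] by simp
  next
    case (limit s a)
    have "(\<lambda>n. s n * U) \<longlonglongrightarrow> a * U" "(\<lambda>n. U * s n) \<longlonglongrightarrow> U * a"
      using limit.hyps(2) by (intro tendsto_intros; simp)+
    then show ?case using limit.IH LIMSEQ_unique by auto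
  qed (simp_all add: distrib_left distrib_right scaleC_mult_left scaleC_mult_right, metis mult.assoc)
  have "a * b = b * a" if "a \<in> B" "b \<in> B" for a b
    using that(2)
  proof (induction rule: B_induct)
    case (iota f)
    then show ?case using com[OF that(1)] by simp
  next
    case U
    then show ?case using comU[OF that(1)] by simp
  next
    case (limit s b)
    have "(\<lambda>n. a * s n) \<longlonglongrightarrow> a * b" "(\<lambda>n. s n * a) \<longlonglongrightarrow> b * a"
      using limit.hyps(2) by (intro tendsto_intros; simp)+
    then show ?case using limit.IH LIMSEQ_unique by auto
  qed (simp_all add: distrib_left distrib_right scaleC_mult_left scaleC_mult_right, metis mult.assoc)
  then show "\<forall>a\<in>B. \<forall>b\<in>B. a * b = b * a" by blast
qed

end

section \<open>Isomorphisms\<close>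

lemma closed_cauchy_domain_eqI:
  assumes K: "K \<in> closed_cauchy_domains" and f: "f \<in> analytic_fun K" "g \<in> analytic_fun K"
    and W: "open W" "W \<noteq> {}" "W \<subseteq> interior K" and eq: "\<And>z. z \<in> W \<Longrightarrow> f z = g z" and z: "z \<in> K"
  shows "f z = g z"
proof -
  note KP = closed_cauchy_domainE[OF K]
  have "f w - g w = 0" if "w \<in> interior K" for w
    using analytic_continuation_open[OF W(1) KP(1) W(2) KP(2) W(3), of f g w] f eq that
    by (simp add: analytic_fun_iff)
  moreover have "continuous_on (closure (interior K)) (\<lambda>z. f z - g z)"
    unfolding KP(4) using f by (intro continuous_intros) (auto simp: analytic_fun_iff)
  ultimately have "f z - g z = 0"
    using continuous_constant_on_closure[of "interior K" "\<lambda>z. f z - g z" 0 z] z KP(4) by blast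
  then show ?thesis by simp
qed

lemma closed_cauchy_domain_constI:
  assumes K: "K \<in> closed_cauchy_domains" and f: "f \<in> analytic_fun K"
    and c: "f constant_on interior K" and zw: "z \<in> K" "w \<in> K"
  shows "f z = f w"
proof -
  note KP = closed_cauchy_domainE[OF K]
  obtain a where a: "\<And>z. z \<in> interior K \<Longrightarrow> f z = a" using c unfolding constant_on_def by blast
  have "f z = a" if "z \<in> K" for z
    using closed_cauchy_domain_eqI[OF K f, of "\<lambda>_. a" "interior K" z] a KP that by simp
  then show ?thesis using zw by simp
qed

lemma closed_cauchy_domain_max_constI:
  assumes K: "K \<in> closed_cauchy_domains" and f: "f \<in> analytic_fun K" and a: "a \<in> interior K"
    and le: "\<And>z. z \<in> K \<Longrightarrow> cmod (f z) \<le> cmod (f a)" and z: "z \<in> K"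
  shows "f z = f a"
proof -
  note KP = closed_cauchy_domainE[OF K]
  have "f constant_on interior K"
    by (rule maximum_modulus_principle[OF _ KP(1,2) KP(1) order_refl a])
      (use f le interior_subset in \<open>auto simp: analytic_fun_iff\<close>)
  then show ?thesis using closed_cauchy_domain_constI[OF K f _ z] a interior_subset by blast
qed

text \<open>The left inverse makes \<open>y\<close> injective, hence nonconstant and open;
  \<open>y \<circ> x\<close> is then the identity on the open image of the interior and by analytic
  continuation on all of \<open>L\<close>.\<close>

lemma closed_cauchy_domain_homeomorphism:
  assumes K: "K \<in> closed_cauchy_domains" and L: "L \<in> closed_cauchy_domains"
    and y: "y \<in> analytic_fun K" "y ` K \<subseteq> L" and x: "x \<in> analytic_fun L" "x ` L \<subseteq> K"
    and xy: "\<And>p. p \<in> K \<Longrightarrow> x (y p) = p"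
  shows "homeomorphism K L y x"
proof -
  note KP = closed_cauchy_domainE[OF K] and LP = closed_cauchy_domainE[OF L]
  have iK: "interior K \<subseteq> K" by (rule interior_subset)
  have nc: "\<not> y constant_on interior K"
  proof
    assume "y constant_on interior K"
    then have "p = q" if "p \<in> interior K" "q \<in> interior K" for p q
      using that xy iK unfolding constant_on_def by (metis subsetD)
    then obtain p where "interior K = {p}" using KP(3) by blast
    then show False using KP(1) not_open_singleton by metis
  qed
  have yi: "y ` interior K \<subseteq> interior L"
    by (rule analytic_fun_maps_interior[OF KP(2) y(1) nc]) (use y(2) iK in blast)
  have "y (x q) = q" if q: "q \<in> L" for q
  proof -
    have "y \<circ> x \<in> analytic_fun L" by (rule analytic_fun_compose[OF LP(2) x y(1)])
    moreover have "open (y ` interior K)"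
      using y(1) by (intro open_mapping_thm[OF _ KP(1,2) KP(1) order_refl nc]) (simp add: analytic_fun_iff)
    ultimately have "(y \<circ> x) q = q"
      using yi KP(3) xy iK q by (intro closed_cauchy_domain_eqI[OF L _ analytic_fun_ident, of "y \<circ> x" "y ` interior K" q]) auto
    then show ?thesis by simp
  qed
  then show ?thesis
    using xy x y by (intro homeomorphismI) (auto simp: analytic_fun_iff)
qed

text \<open>By the maximum principle every circle of radius below \<open>R\<close> contains a point
  where |f| is at least half of |f 0|; such points accumulate at the circle of radius
  \<open>R\<close>. The hypothesis speaks of subsequences because Montel's theorem will supply no
  more.\<close>

lemma holomorphic_vanishing_at_circle:
  assumes f: "f holomorphic_on ball 0 R" and R: "R > 0"
    and lim: "\<And>w l. (\<And>n. cmod (w n) < R) \<Longrightarrow> w \<longlonglongrightarrow> l \<Longrightarrow> cmod l = R \<Longrightarrow>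
      \<exists>r. strict_mono (r :: nat \<Rightarrow> nat) \<and> (\<lambda>n. f (w (r n))) \<longlonglongrightarrow> 0"
  shows "f 0 = 0"
proof (rule ccontr)
  assume "f 0 \<noteq> 0"
  then have e: "cmod (f 0) / 2 > 0" by simp
  define \<rho> where "\<rho> n = R * (real n / real (Suc n))" for n
  have "(\<lambda>n. R * (real n / real (Suc n))) \<longlonglongrightarrow> R * 1"
    by (intro tendsto_intros LIMSEQ_n_over_Suc_n)
  then have \<rho>lim: "\<rho> \<longlonglongrightarrow> R" by (simp add: \<rho>_def[abs_def] del: of_nat_Suc)
  have \<rho>: "0 \<le> \<rho> n" "\<rho> n < R" for n using R by (auto simp: \<rho>_def field_simps)
  have "\<exists>w. cmod w = \<rho> n \<and> cmod (f w) \<ge> cmod (f 0) / 2" for n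
  proof (rule ccontr)
    assume "\<not> ?thesis"
    then have lt: "\<And>w. cmod w = \<rho> n \<Longrightarrow> cmod (f w) \<le> cmod (f 0) / 2" by (metis linear)
    have sub: "cball 0 (\<rho> n) \<subseteq> ball 0 R" using \<rho>[of n] by auto
    have "cmod (f 0) \<le> cmod (f 0) / 2"
    proof (rule maximum_modulus_frontier[of f "cball 0 (\<rho> n)"])
      show "f holomorphic_on interior (cball 0 (\<rho> n))"
        using f sub interior_subset holomorphic_on_subset by blast
      show "continuous_on (closure (cball 0 (\<rho> n))) f"
        using holomorphic_on_imp_continuous_on[OF f] sub by (auto intro: continuous_on_subset)
      show "z \<in> frontier (cball 0 (\<rho> n)) \<Longrightarrow> cmod (f z) \<le> cmod (f 0) / 2" for z
        using lt by auto
    qed (use \<rho>[of n] in auto)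
    then show False using e by simp
  qed
  then obtain w where w: "\<And>n. cmod (w n) = \<rho> n" "\<And>n. cmod (f (w n)) \<ge> cmod (f 0) / 2" by metis
  have "\<And>n. w n \<in> cball 0 R" using w(1) \<rho> by (simp add: less_imp_le)
  then obtain l s where s: "strict_mono s" "(w \<circ> s) \<longlonglongrightarrow> l"
    using compact_cball[of "0::complex" R] unfolding compact_def by metis
  have "(\<lambda>n. cmod ((w \<circ> s) n)) \<longlonglongrightarrow> cmod l" by (intro tendsto_norm s)
  moreover have "(\<lambda>n. cmod ((w \<circ> s) n)) \<longlonglongrightarrow> R"
    using LIMSEQ_subseq_LIMSEQ[OF \<rho>lim s(1)] w(1) by (simp add: o_def)
  ultimately have "cmod l = R" by (rule LIMSEQ_unique)
  then obtain r where "(\<lambda>n. f ((w \<circ> s) (r n))) \<longlonglongrightarrow> 0"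
    using lim[of "w \<circ> s" l] s(2) w(1) \<rho>(2) by auto
  then have "(\<lambda>n. cmod (f ((w \<circ> s) (r n)))) \<longlonglongrightarrow> 0" by (rule tendsto_norm_zero)
  then have "cmod (f 0) / 2 \<le> 0"
    using w(2) by (intro LIMSEQ_le_const[of "\<lambda>n. cmod (f ((w \<circ> s) (r n)))"]) auto
  then show False using e by simp
qed

lemma holomorphic_bounded_subsequence:
  assumes S: "open S" and f: "\<And>n. f n holomorphic_on S" "\<And>n z. z \<in> S \<Longrightarrow> cmod (f n z) \<le> M"
  obtains g r where "g holomorphic_on S" "strict_mono (r :: nat \<Rightarrow> nat)"
    "\<And>z. z \<in> S \<Longrightarrow> (\<lambda>n. f (r n) z) \<longlonglongrightarrow> g z"
proof -
  let ?H = "{h. h holomorphic_on S \<and> (\<forall>z\<in>S. cmod (h z) \<le> M)}"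
  obtain g r where "g holomorphic_on S" "strict_mono (r :: nat \<Rightarrow> nat)"
    "\<And>z. z \<in> S \<Longrightarrow> (\<lambda>n. f (r n) z) \<longlonglongrightarrow> g z"
  proof (rule Montel[OF S, of ?H f])
    show "\<exists>B. \<forall>h\<in>?H. \<forall>z\<in>C. cmod (h z) \<le> B" if "C \<subseteq> S" for C
      using that by (intro exI[of _ M]) blast
  qed (use f in auto)
  then show thesis using that by blast
qed

lemma algebra_isomorphism_one:
  assumes "algebra_isomorphism A B \<phi>" "1 \<in> A" "1 \<in> B" shows "\<phi> 1 = 1"
proof -
  obtain a where a: "a \<in> A" "\<phi> a = 1"
    using assms unfolding algebra_isomorphism_def bij_betw_def by (metis imageE)
  then have "\<phi> (1 * a) = \<phi> 1 * \<phi> a" using assms unfolding algebra_isomorphism_def by blast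
  then show ?thesis using a by simp
qed

section \<open>Transport of characters and the maps between the cores\<close>

text \<open>The inverse is a parameter so that \<open>inverse\<close> can interpret the locale with
  the two algebras exchanged; each result is then available in both directions.\<close>

locale conjugacy_isomorphism =
  A1: analytic_conjugacy_algebra K\<^sub>1 \<eta>\<^sub>1 \<iota>\<^sub>1 U\<^sub>1 E\<^sub>1 + A2: analytic_conjugacy_algebra K\<^sub>2 \<eta>\<^sub>2 \<iota>\<^sub>2 U\<^sub>2 E\<^sub>2
  for K\<^sub>1 K\<^sub>2 :: "complex set"
    and \<eta>\<^sub>1 \<eta>\<^sub>2 :: "complex \<Rightarrow> complex"
    and \<iota>\<^sub>1 :: "(complex \<Rightarrow> complex) \<Rightarrow> 'a::complex_banach_algebra_1"
    and \<iota>\<^sub>2 :: "(complex \<Rightarrow> complex) \<Rightarrow> 'b::complex_banach_algebra_1"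
    and U\<^sub>1 U\<^sub>2 E\<^sub>1 E\<^sub>2 +
  fixes \<phi> :: "'a \<Rightarrow> 'b" and \<psi> :: "'b \<Rightarrow> 'a"
  assumes iso: "algebra_isomorphism A1.B A2.B \<phi>"
    and psi_phi: "a \<in> A1.B \<Longrightarrow> \<psi> (\<phi> a) = a" and phi_psi: "b \<in> A2.B \<Longrightarrow> \<phi> (\<psi> b) = b"
begin

lemma phi_in: "a \<in> A1.B \<Longrightarrow> \<phi> a \<in> A2.B"
  using iso unfolding algebra_isomorphism_def bij_betw_def by blast

lemma psi_in:
  assumes "b \<in> A2.B" shows "\<psi> b \<in> A1.B"
proof -
  have "\<phi> ` A1.B = A2.B" using iso unfolding algebra_isomorphism_def bij_betw_def by blast
  then obtain a where "a \<in> A1.B" "b = \<phi> a" using assms by blast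
  then show ?thesis using psi_phi by simp
qed

lemma iso_inverse: "algebra_isomorphism A2.B A1.B \<psi>"
proof -
  have hom: "\<phi> (a + b) = \<phi> a + \<phi> b" "\<phi> (a * b) = \<phi> a * \<phi> b" "\<phi> (c *\<^sub>C a) = c *\<^sub>C \<phi> a"
    if "a \<in> A1.B" "b \<in> A1.B" for a b c
    using iso that unfolding algebra_isomorphism_def by auto
  have "bij_betw \<psi> A2.B A1.B"
    using phi_in psi_in by (intro bij_betwI[where g=\<phi>]) (auto simp: psi_phi phi_psi)
  moreover have "\<psi> (a + b) = \<psi> a + \<psi> b" "\<psi> (a * b) = \<psi> a * \<psi> b" "\<psi> (c *\<^sub>C a) = c *\<^sub>C \<psi> a"
    if ab: "a \<in> A2.B" "b \<in> A2.B" for a b c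
  proof -
    have "\<phi> (\<psi> a + \<psi> b) = a + b" "\<phi> (\<psi> a * \<psi> b) = a * b" "\<phi> (c *\<^sub>C \<psi> a) = c *\<^sub>C a"
      using hom[OF psi_in[OF ab(1)] psi_in[OF ab(2)]] ab by (simp_all add: phi_psi)
    then show "\<psi> (a + b) = \<psi> a + \<psi> b" "\<psi> (a * b) = \<psi> a * \<psi> b" "\<psi> (c *\<^sub>C a) = c *\<^sub>C \<psi> a"
      using psi_phi psi_in[OF ab(1)] psi_in[OF ab(2)] A1.B_add A1.B_mult A1.B_scale by metis+
  qed
  ultimately show ?thesis unfolding algebra_isomorphism_def by blast
qed

lemma inverse: "conjugacy_isomorphism K\<^sub>2 K\<^sub>1 \<eta>\<^sub>2 \<eta>\<^sub>1 \<iota>\<^sub>2 \<iota>\<^sub>1 U\<^sub>2 U\<^sub>1 E\<^sub>2 E\<^sub>1 \<psi> \<phi>"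
  using iso_inverse phi_psi psi_phi
  by (intro conjugacy_isomorphism.intro conjugacy_isomorphism_axioms.intro
      A1.analytic_conjugacy_algebra_axioms A2.analytic_conjugacy_algebra_axioms) auto

lemma psi_character:
  assumes \<theta>: "character_on A1.B \<theta>" shows "character_on A2.B (\<lambda>b. \<theta> (\<psi> b))"
proof -
  have "\<psi> 1 = 1" using algebra_isomorphism_one[OF iso_inverse A2.one_in_B A1.one_in_B] .
  then show ?thesis
    using \<theta> iso_inverse psi_in unfolding character_on_def algebra_isomorphism_def by auto
qed

definition y :: "complex \<Rightarrow> complex" where
  "y p = E\<^sub>1 (\<psi> (\<iota>\<^sub>2 (\<lambda>z. z))) p"

definition v :: "complex \<Rightarrow> complex" where
  "v p = E\<^sub>1 (\<psi> U\<^sub>2) p"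

lemma ident_in_B: "\<iota>\<^sub>1 (\<lambda>z. z) \<in> A1.B" "\<iota>\<^sub>2 (\<lambda>z. z) \<in> A2.B"
  by (auto intro: A1.iota_in_B A2.iota_in_B)

lemma core_character: "p \<in> K\<^sub>1 \<Longrightarrow> character_on A2.B (\<lambda>b. E\<^sub>1 (\<psi> b) p)"
  by (rule psi_character[OF A1.E0_char])

lemma y_analytic: "y \<in> analytic_fun K\<^sub>1" and v_analytic: "v \<in> analytic_fun K\<^sub>1"
  using A1.E0_analytic[OF psi_in[OF ident_in_B(2)]] A1.E0_analytic[OF psi_in[OF A2.U_in_B]]
  by (simp_all add: y_def[abs_def] v_def[abs_def])

lemma y_in: "p \<in> K\<^sub>1 \<Longrightarrow> y p \<in> K\<^sub>2"
  using A2.character_eval(1)[OF core_character] by (simp add: y_def)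

lemma y_image: "y ` K\<^sub>1 \<subseteq> K\<^sub>2"
  using y_in by blast

lemma v_le: "p \<in> K\<^sub>1 \<Longrightarrow> cmod (v p) \<le> A2.rad"
  using A2.character_U_le[OF core_character] by (simp add: v_def)

lemma y_fixed: "p \<in> K\<^sub>1 \<Longrightarrow> v p = 0 \<or> \<eta>\<^sub>2 (y p) = y p"
  using A2.character_covariant[OF core_character] by (simp add: y_def v_def)

text \<open>The condition \<open>v p = 0\<close> gives the transported character the same two
  coordinates as the core character at \<open>y p\<close>.\<close>

lemma core_eq_core:
  assumes p: "p \<in> K\<^sub>1" "v p = 0" and b: "b \<in> A2.B"
  shows "E\<^sub>1 (\<psi> b) p = E\<^sub>2 b (y p)"
  using p A2.E0_U[OF y_in[OF p(1)]]
  by (intro A2.character_eqI[OF core_character[OF p(1)] A2.E0_char[OF y_in[OF p(1)]] _ _ b])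
    (simp_all add: A2.E0_iota[OF A2.analytic_cont y_in] y_def[symmetric] v_def[symmetric])

lemma character_eq_Theta:
  assumes \<theta>: "character_on A1.B \<theta>" and fixed: "\<eta>\<^sub>2 (\<theta> (\<psi> (\<iota>\<^sub>2 (\<lambda>z. z)))) = \<theta> (\<psi> (\<iota>\<^sub>2 (\<lambda>z. z)))"
    and lt: "cmod (\<theta> (\<psi> U\<^sub>2)) < A2.rad" and b: "b \<in> A2.B"
  shows "\<theta> (\<psi> b) = A2.\<Theta> (\<theta> (\<psi> (\<iota>\<^sub>2 (\<lambda>z. z)))) (\<theta> (\<psi> U\<^sub>2)) b"
proof -
  have in2: "\<theta> (\<psi> (\<iota>\<^sub>2 (\<lambda>z. z))) \<in> K\<^sub>2" by (rule A2.character_eval(1)[OF psi_character[OF \<theta>]])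
  show ?thesis
    by (rule A2.character_eqI[OF psi_character[OF \<theta>] A2.Theta_char[OF in2 fixed lt] _ _ b])
      (simp_all add: A2.Theta_ident[OF in2 lt] A2.Theta_U[OF in2 lt])
qed

text \<open>If \<open>y\<close> is constant, the isomorphism carries \<open>K\<^sub>1\<close> into the disc of characters over one
  fixed point of \<open>\<eta>\<^sub>2\<close>, and in fact onto it.\<close>
lemma y_constant_imp_simply_connected:
  assumes yc: "y constant_on interior K\<^sub>1" shows "simply_connected K\<^sub>1"
proof -
  note KP = A1.K_props
  have iK: "interior K\<^sub>1 \<subseteq> K\<^sub>1" by (rule interior_subset)
  obtain p0 where p0: "p0 \<in> K\<^sub>1" using A1.K_nonempty by blast
  define y0 where "y0 = y p0"
  have yy: "y p = y0" if "p \<in> K\<^sub>1" for p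
    unfolding y0_def by (rule closed_cauchy_domain_constI[OF A1.K_cauchy y_analytic yc that p0])
  have y0: "y0 \<in> K\<^sub>2" using y_in[OF p0] by (simp add: y0_def)
  have inj: "inj_on v K\<^sub>1"
  proof (rule inj_onI)
    fix p q assume p: "p \<in> K\<^sub>1" and q: "q \<in> K\<^sub>1" and "v p = v q"
    then have "E\<^sub>1 (\<psi> (\<phi> (\<iota>\<^sub>1 (\<lambda>z. z)))) p = E\<^sub>1 (\<psi> (\<phi> (\<iota>\<^sub>1 (\<lambda>z. z)))) q"
      using yy[OF p] yy[OF q]
      by (intro A2.character_eqI[OF core_character[OF p] core_character[OF q] _ _ phi_in[OF ident_in_B(1)]])
        (simp_all add: y_def[symmetric] v_def[symmetric])
    then show "p = q"
      using p q by (simp add: psi_phi ident_in_B A1.E0_iota A1.analytic_cont)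
  qed
  have nc: "\<not> v constant_on interior K\<^sub>1"
  proof
    assume "v constant_on interior K\<^sub>1"
    then have "p = q" if "p \<in> interior K\<^sub>1" "q \<in> interior K\<^sub>1" for p q
      using that inj iK unfolding constant_on_def inj_on_def by (metis subsetD)
    then obtain p where "interior K\<^sub>1 = {p}" using KP(3) by blast
    then show False using KP(1) not_open_singleton by metis
  qed
  then obtain p1 where p1: "p1 \<in> interior K\<^sub>1" "v p1 \<noteq> 0" unfolding constant_on_def by blast
  have fix0: "\<eta>\<^sub>2 y0 = y0" using y_fixed[of p1] p1 iK yy by auto
  \<comment> \<open>By the open mapping theorem \<open>v\<close> keeps interior points off the
    bounding circle, so that power series characters apply to them.\<close>
  have "v ` interior K\<^sub>1 \<subseteq> interior (cball 0 A2.rad)"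
    using v_le iK by (intro analytic_fun_maps_interior[OF KP(2) v_analytic nc]) auto
  then have vi: "cmod (v p) < A2.rad" if "p \<in> interior K\<^sub>1" for p using that by auto
  \<comment> \<open>The candidate for the inverse of \<open>v\<close>: the base point in
    \<open>K\<^sub>1\<close> of the character at \<open>y0\<close> and \<open>w\<close>, transported
    to the first algebra.\<close>
  define h where "h w = A2.\<Theta> y0 w (\<phi> (\<iota>\<^sub>1 (\<lambda>z. z)))" for w
  interpret inv: conjugacy_isomorphism K\<^sub>2 K\<^sub>1 \<eta>\<^sub>2 \<eta>\<^sub>1 \<iota>\<^sub>2 \<iota>\<^sub>1 U\<^sub>2 U\<^sub>1 E\<^sub>2 E\<^sub>1 \<psi> \<phi> by (rule inverse)
  have hK: "h w \<in> K\<^sub>1" if "w \<in> ball 0 A2.rad" for w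
    using A1.character_eval(1)[OF inv.psi_character[OF A2.Theta_char[OF y0 fix0, of w]]] that
    by (simp add: h_def)
  have hv: "h (v p) = p" if p: "p \<in> interior K\<^sub>1" for p
  proof -
    have pK: "p \<in> K\<^sub>1" using p iK by blast
    have "E\<^sub>1 (\<psi> (\<phi> (\<iota>\<^sub>1 (\<lambda>z. z)))) p = A2.\<Theta> y0 (v p) (\<phi> (\<iota>\<^sub>1 (\<lambda>z. z)))"
      using character_eq_Theta[OF A1.E0_char[OF pK] _ _ phi_in[OF ident_in_B(1)]] vi[OF p] yy[OF pK] fix0
      by (simp add: y_def[symmetric] v_def[symmetric])
    then show ?thesis using pK by (simp add: h_def psi_phi ident_in_B A1.E0_iota A1.analytic_cont)
  qed
  have hh: "h holomorphic_on ball 0 A2.rad"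
    using A2.Theta_holomorphic[OF y0] by (simp add: h_def[abs_def])
  have vsub: "v ` interior K\<^sub>1 \<subseteq> ball 0 A2.rad" using vi by auto
  have hnc: "\<not> h constant_on ball 0 A2.rad"
  proof
    assume "h constant_on ball 0 A2.rad"
    then have "p = q" if "p \<in> interior K\<^sub>1" "q \<in> interior K\<^sub>1" for p q
      using that hv vsub unfolding constant_on_def by (metis image_subset_iff)
    then obtain p where "interior K\<^sub>1 = {p}" using KP(3) by blast
    then show False using KP(1) not_open_singleton by metis
  qed
  have "open (h ` ball 0 A2.rad)"
    by (rule open_mapping_thm[OF hh open_ball connected_ball open_ball order_refl hnc])
  then have hi: "h ` ball 0 A2.rad \<subseteq> interior K\<^sub>1" using hK by (intro interior_maximal) auto
  have vh: "v (h w) = w" if w: "w \<in> ball 0 A2.rad" for w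
  proof -
    have vhol: "v holomorphic_on interior K\<^sub>1" using v_analytic by (simp add: analytic_fun_iff)
    have "open (v ` interior K\<^sub>1)" by (rule open_mapping_thm[OF vhol KP(1,2) KP(1) order_refl nc])
    moreover have "v \<circ> h holomorphic_on ball 0 A2.rad"
      by (rule holomorphic_on_compose_gen[OF hh vhol hi])
    ultimately have "(v \<circ> h) w = w"
      using vsub KP(3) hv w
      by (intro analytic_continuation_open[of "v ` interior K\<^sub>1" "ball 0 A2.rad" "v \<circ> h" "\<lambda>w. w" w]) auto
    then show ?thesis by simp
  qed
  have cv: "continuous_on K\<^sub>1 v" using v_analytic by (simp add: analytic_fun_iff)
  \<comment> \<open>The inverse is available over the open disc only; compactness of the image adds
    the circle.\<close>
  have "ball 0 A2.rad \<subseteq> v ` K\<^sub>1" using vh hK by (metis imageI subsetI)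
  moreover have "closed (v ` K\<^sub>1)"
    using compact_continuous_image[OF cv A1.compact_space] compact_imp_closed by blast
  ultimately have "closure (ball 0 A2.rad) \<subseteq> v ` K\<^sub>1" by (rule closure_minimal)
  then have "cball 0 A2.rad \<subseteq> v ` K\<^sub>1" using A2.rad_pos by simp
  moreover have "v ` K\<^sub>1 \<subseteq> cball 0 A2.rad" using v_le by auto
  ultimately have "v ` K\<^sub>1 = cball 0 A2.rad" by blast
  then have "K\<^sub>1 homeomorphic cball (0::complex) A2.rad"
    using homeomorphism_compact[OF A1.compact_space cv _ inj] unfolding homeomorphic_def by blast
  then show ?thesis
    using homeomorphic_simply_connected_eq convex_imp_simply_connected convex_cball by blast
qed

end

section \<open>Conjugacy when the core is preserved\<close>

context conjugacy_isomorphism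
begin

lemma eta_ident_transfer:
  assumes "\<And>p. p \<in> K\<^sub>1 \<Longrightarrow> \<eta>\<^sub>1 p = p" "q \<in> K\<^sub>2" shows "\<eta>\<^sub>2 q = q"
proof -
  have com: "\<forall>a\<in>A1.B. \<forall>b\<in>A1.B. a * b = b * a" using A1.commutative_iff_eta assms(1) by blast
  have "a * b = b * a" if ab: "a \<in> A2.B" "b \<in> A2.B" for a b
  proof -
    have "\<phi> (\<psi> a * \<psi> b) = a * b" "\<phi> (\<psi> b * \<psi> a) = b * a"
      using iso psi_in ab unfolding algebra_isomorphism_def by (simp_all add: phi_psi)
    then show ?thesis using com psi_in ab by metis
  qed
  then show ?thesis using A2.commutative_iff_eta assms(2) by blast
qed

text \<open>\<open>coeff 1\<close> is a point derivation with respect to the characters at \<open>p\<close> and \<open>\<eta>\<^sub>1 p\<close>; transported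
  to the second algebra it becomes one with respect to \<open>y p\<close> and \<open>y (\<eta>\<^sub>1 p)\<close>, which the covariance
  relation forces to be related by \<open>\<eta>\<^sub>2\<close>.\<close>
lemma y_conjugates_nonfixed:
  assumes v0: "\<And>p. p \<in> K\<^sub>1 \<Longrightarrow> v p = 0" and inj: "inj_on y K\<^sub>1"
    and p: "p \<in> K\<^sub>1" "\<eta>\<^sub>1 p \<noteq> p"
  shows "y (\<eta>\<^sub>1 p) = \<eta>\<^sub>2 (y p)"
proof (rule ccontr)
  assume ne: "y (\<eta>\<^sub>1 p) \<noteq> \<eta>\<^sub>2 (y p)"
  define P Q where "P = y p" and "Q = y (\<eta>\<^sub>1 p)"
  have ep: "\<eta>\<^sub>1 p \<in> K\<^sub>1" using A1.eta_in[OF p(1)] .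
  have PQ: "P \<in> K\<^sub>2" "Q \<in> K\<^sub>2" "P \<noteq> Q"
    using y_in p ep inj unfolding P_def Q_def inj_on_def by auto
  define D where "D b = A1.coeff 1 (\<psi> b) p" for b
  have D: "D (b * c) = E\<^sub>2 b P * D c + D b * E\<^sub>2 c Q" if "b \<in> A2.B" "c \<in> A2.B" for b c
  proof -
    have "\<psi> (b * c) = \<psi> b * \<psi> c" using iso_inverse that unfolding algebra_isomorphism_def by blast
    then show ?thesis
      using A1.coeff_1_mult[OF p(1)] core_eq_core[OF p(1) v0[OF p(1)] that(1)]
        core_eq_core[OF ep v0[OF ep] that(2)]
      by (simp add: D_def P_def Q_def)
  qed
  have Dadd: "D (b + c) = D b + D c" if "b \<in> A2.B" "c \<in> A2.B" for b c
  proof -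
    have "\<psi> (b + c) = \<psi> b + \<psi> c" using iso_inverse that unfolding algebra_isomorphism_def by blast
    then show ?thesis using A1.coeff_add[OF p(1), of 1] by (simp only: D_def)
  qed
  have Ei: "E\<^sub>2 (\<iota>\<^sub>2 f) q = f q" if "f \<in> analytic_fun K\<^sub>2" "q \<in> K\<^sub>2" for f q
    using that by (intro A2.E0_iota A2.analytic_cont)
  note BI = A2.iota_in_B A2.U_in_B A2.eta_analytic analytic_fun_ident
  have "U\<^sub>2 * \<iota>\<^sub>2 (\<lambda>z. z) = \<iota>\<^sub>2 \<eta>\<^sub>2 * U\<^sub>2"
    using A2.covariant[OF A2.analytic_cont[OF analytic_fun_ident]] by (simp add: o_def)
  \<comment> \<open>In \<open>D\<close> of the covariance relation the terms with
    \<open>E\<^sub>2 U\<^sub>2\<close> vanish; the remaining ones force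
    \<open>D U\<^sub>2 = 0\<close> since \<open>Q\<close> is not
    \<open>\<eta>\<^sub>2 P\<close>.\<close>
  then have "D U\<^sub>2 * Q = \<eta>\<^sub>2 P * D U\<^sub>2"
    using D[of U\<^sub>2 "\<iota>\<^sub>2 (\<lambda>z. z)"] D[of "\<iota>\<^sub>2 \<eta>\<^sub>2" U\<^sub>2] PQ by (auto simp: BI A2.E0_U Ei)
  then have DU: "D U\<^sub>2 = 0" using ne by (auto simp: P_def Q_def)
  \<comment> \<open>Comparing \<open>D\<close> of the equal products f z and z f expresses
    \<open>D\<close> on functions by its value at z; in particular \<open>D\<close> vanishes on
    functions with equal values at \<open>P\<close> and \<open>Q\<close>.\<close>
  have Df: "D (\<iota>\<^sub>2 f) * (Q - P) = D (\<iota>\<^sub>2 (\<lambda>z. z)) * (f Q - f P)" if f: "f \<in> analytic_fun K\<^sub>2" for f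
  proof -
    have "\<iota>\<^sub>2 f * \<iota>\<^sub>2 (\<lambda>z. z) = \<iota>\<^sub>2 (\<lambda>z. z) * \<iota>\<^sub>2 f"
      using A2.iota_mult[OF A2.analytic_cont[OF f] A2.analytic_cont[OF analytic_fun_ident]]
        A2.iota_mult[OF A2.analytic_cont[OF analytic_fun_ident] A2.analytic_cont[OF f]]
      by (simp add: mult.commute)
    then have "f P * D (\<iota>\<^sub>2 (\<lambda>z. z)) + D (\<iota>\<^sub>2 f) * Q = P * D (\<iota>\<^sub>2 f) + D (\<iota>\<^sub>2 (\<lambda>z. z)) * f Q"
      using D[of "\<iota>\<^sub>2 f" "\<iota>\<^sub>2 (\<lambda>z. z)"] D[of "\<iota>\<^sub>2 (\<lambda>z. z)" "\<iota>\<^sub>2 f"] PQ f by (simp add: BI Ei)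
    then show ?thesis by (simp add: algebra_simps)
  qed
  \<comment> \<open>The test element: its constant term vanishes at \<open>P\<close> and
    \<open>Q\<close>, so the rules above give \<open>D b = 0\<close>, whereas the first coefficient
    of \<open>U\<^sub>1\<close> is 1.\<close>
  define b where "b = \<phi> U\<^sub>1"
  have b: "b \<in> A2.B" "\<psi> b = U\<^sub>1" by (simp_all add: b_def phi_in psi_phi A1.U_in_B)
  have f: "E\<^sub>2 b \<in> analytic_fun K\<^sub>2" by (rule A2.E0_analytic[OF b(1)])
  have f0: "E\<^sub>2 b P = 0" "E\<^sub>2 b Q = 0"
    using core_eq_core[OF p(1) v0[OF p(1)] b(1)] core_eq_core[OF ep v0[OF ep] b(1)]
    by (simp_all add: P_def Q_def b(2) A1.E0_U p(1) ep)
  have t: "A2.tail b \<in> A2.B" by (rule A2.tail_in_B[OF b(1)])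
  have "D b = D (\<iota>\<^sub>2 (E\<^sub>2 b)) + D (A2.tail b * U\<^sub>2)"
    using Dadd[OF A2.iota_in_B[OF f] A2.B_mult[OF t A2.U_in_B]] A2.tail_decomp[of b] by simp
  also have "D (A2.tail b * U\<^sub>2) = 0" using D[OF t A2.U_in_B] DU PQ by (simp add: A2.E0_U)
  finally have "D b * (Q - P) = 0" using Df[OF f] f0 by simp
  then have "D b = 0" using PQ by simp
  moreover have "D b = 1"
    using p(1) A1.tail_mult_U[of 1] A1.E0_character[OF p(1)]
    by (simp add: D_def b(2) A1.coeff_Suc character_on_def del: coeff_map.simps(2))
  ultimately show False by simp
qed

text \<open>If \<open>\<eta>\<^sub>1\<close> is not the identity, its nonfixed points contain a
  nonempty open set, from which analytic continuation extends the relation. The identity is settled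
  by commutativity, since the derivation argument divides by \<open>Q - P\<close>, which is 0 at
  fixed points.\<close>

lemma y_conjugates:
  assumes v0: "\<And>p. p \<in> K\<^sub>1 \<Longrightarrow> v p = 0" and inj: "inj_on y K\<^sub>1" and p: "p \<in> K\<^sub>1"
  shows "y (\<eta>\<^sub>1 p) = \<eta>\<^sub>2 (y p)"
proof (cases "\<forall>p\<in>K\<^sub>1. \<eta>\<^sub>1 p = p")
  case True
  then show ?thesis using eta_ident_transfer p y_in by simp
next
  case False
  note KP = A1.K_props
  define W where "W = {p \<in> interior K\<^sub>1. \<eta>\<^sub>1 p - p \<noteq> 0}"
  have "continuous_on (interior K\<^sub>1) (\<lambda>p. \<eta>\<^sub>1 p - p)"
    using A1.eta_analytic interior_subset
    by (intro continuous_intros) (auto simp: analytic_fun_iff intro: continuous_on_subset)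
  then have "open (interior K\<^sub>1 \<inter> (\<lambda>p. \<eta>\<^sub>1 p - p) -` (- {0}))"
    by (intro continuous_open_preimage) auto
  moreover have "W = interior K\<^sub>1 \<inter> (\<lambda>p. \<eta>\<^sub>1 p - p) -` (- {0})" by (auto simp: W_def)
  ultimately have oW: "open W" by simp
  have "W \<noteq> {}"
  proof
    assume "W = {}"
    then have "\<eta>\<^sub>1 q = q" if "q \<in> K\<^sub>1" for q
      using that KP by (intro closed_cauchy_domain_eqI[OF A1.K_cauchy A1.eta_analytic analytic_fun_ident, of "interior K\<^sub>1" q])
        (auto simp: W_def)
    then show False using False by blast
  qed
  moreover have "y \<circ> \<eta>\<^sub>1 \<in> analytic_fun K\<^sub>1"
    by (rule analytic_fun_compose[OF KP(2) A1.eta_analytic A1.eta_into y_analytic])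
  moreover have "\<eta>\<^sub>2 \<circ> y \<in> analytic_fun K\<^sub>1"
    by (rule analytic_fun_compose[OF KP(2) y_analytic y_image A2.eta_analytic])
  ultimately have "(y \<circ> \<eta>\<^sub>1) p = (\<eta>\<^sub>2 \<circ> y) p"
    using oW p y_conjugates_nonfixed[OF v0 inj] interior_subset[of K\<^sub>1]
    by (intro closed_cauchy_domain_eqI[OF A1.K_cauchy, of "y \<circ> \<eta>\<^sub>1" "\<eta>\<^sub>2 \<circ> y" W p]) (auto simp: W_def)
  then show ?thesis by simp
qed

text \<open>\<open>core_eq_core\<close> at the image of the identity function shows that
  \<open>inv.y\<close> is a left inverse of \<open>y\<close>. That the inverse isomorphism preserves
  the core as well is not presupposed, since rigidity turns the left inverse into an
  inverse.\<close>

lemma conjugate_if_core_preserved: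
  assumes v0: "\<And>p. p \<in> K\<^sub>1 \<Longrightarrow> v p = 0"
  shows "\<exists>x. homeomorphism K\<^sub>1 K\<^sub>2 y x \<and> (\<forall>p\<in>K\<^sub>1. y (\<eta>\<^sub>1 p) = \<eta>\<^sub>2 (y p))"
proof -
  interpret inv: conjugacy_isomorphism K\<^sub>2 K\<^sub>1 \<eta>\<^sub>2 \<eta>\<^sub>1 \<iota>\<^sub>2 \<iota>\<^sub>1 U\<^sub>2 U\<^sub>1 E\<^sub>2 E\<^sub>1 \<psi> \<phi> by (rule inverse)
  have xy: "inv.y (y p) = p" if "p \<in> K\<^sub>1" for p
    using core_eq_core[OF that v0[OF that] phi_in[OF ident_in_B(1)]] that
    by (simp add: inv.y_def psi_phi ident_in_B A1.E0_iota A1.analytic_cont)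
  have "homeomorphism K\<^sub>1 K\<^sub>2 y inv.y"
    by (rule closed_cauchy_domain_homeomorphism[OF A1.K_cauchy A2.K_cauchy y_analytic y_image
          inv.y_analytic inv.y_image xy])
  moreover have "inj_on y K\<^sub>1" using xy by (metis inj_onI)
  ultimately show ?thesis using y_conjugates[OF v0] by blast
qed

section \<open>The commutative case\<close>

text \<open>A core character of the second algebra annihilates \<open>U\<^sub>2\<close>. Transported
  to the first algebra it is, at this element, a limit of values of \<open>\<Theta>\<close>, and
  these are all \<open>c\<close>.\<close>

lemma Theta_U_not_constant:
  assumes id: "\<And>p. p \<in> K\<^sub>1 \<Longrightarrow> \<eta>\<^sub>1 p = p"
    and c: "\<And>z w. z \<in> K\<^sub>1 \<Longrightarrow> cmod w < A1.rad \<Longrightarrow> A1.\<Theta> z w (\<psi> U\<^sub>2) = c"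
  shows "c = 0"
proof -
  interpret inv: conjugacy_isomorphism K\<^sub>2 K\<^sub>1 \<eta>\<^sub>2 \<eta>\<^sub>1 \<iota>\<^sub>2 \<iota>\<^sub>1 U\<^sub>2 U\<^sub>1 E\<^sub>2 E\<^sub>1 \<psi> \<phi> by (rule inverse)
  obtain q where q: "q \<in> K\<^sub>2" using A2.K_nonempty by blast
  note \<theta> = inv.core_character[OF q]
  obtain u where u: "\<And>n. cmod (u n) < A1.rad"
    "(\<lambda>n. A1.\<Theta> (E\<^sub>2 (\<phi> (\<iota>\<^sub>1 (\<lambda>z. z))) q) (u n) (\<psi> U\<^sub>2)) \<longlonglongrightarrow> E\<^sub>2 (\<phi> (\<psi> U\<^sub>2)) q"
    using A1.character_limit_Theta[OF id \<theta> psi_in[OF A2.U_in_B]] by metis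
  then have "(\<lambda>n. c) \<longlonglongrightarrow> E\<^sub>2 U\<^sub>2 q"
    using c[OF A1.character_eval(1)[OF \<theta>] u(1)] by (simp add: phi_psi A2.U_in_B)
  then show ?thesis using A2.E0_U[OF q] by (simp add: LIMSEQ_const_iff)
qed

text \<open>The argument of Remmert and Stein: a limit of the maps \<open>z \<mapsto> (H\<^sub>1 z (w n), H\<^sub>2 z (w n))\<close> as
  \<open>w n\<close> tends to the boundary of the disc has its values in the boundary of the product domain,
  so that one of its two components is constant.\<close>
lemma Theta_boundary_product:
  assumes id1: "\<And>p. p \<in> K\<^sub>1 \<Longrightarrow> \<eta>\<^sub>1 p = p" and id2: "\<And>q. q \<in> K\<^sub>2 \<Longrightarrow> \<eta>\<^sub>2 q = q"
    and z: "z0 \<in> interior K\<^sub>1" "z1 \<in> interior K\<^sub>1" "z2 \<in> interior K\<^sub>1"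
    and w: "\<And>n. cmod (w n) < A1.rad" "w \<longlonglongrightarrow> l" "cmod l = A1.rad"
  defines "H\<^sub>1 \<equiv> (\<lambda>z w. A1.\<Theta> z w (\<psi> (\<iota>\<^sub>2 (\<lambda>z. z))))" and "H\<^sub>2 \<equiv> (\<lambda>z w. A1.\<Theta> z w (\<psi> U\<^sub>2))"
  shows "\<exists>r. strict_mono (r :: nat \<Rightarrow> nat) \<and>
    (\<lambda>n. (H\<^sub>1 z1 (w (r n)) - H\<^sub>1 z0 (w (r n))) * (H\<^sub>2 z2 (w (r n)) - H\<^sub>2 z0 (w (r n)))) \<longlonglongrightarrow> 0"
proof -
  interpret inv: conjugacy_isomorphism K\<^sub>2 K\<^sub>1 \<eta>\<^sub>2 \<eta>\<^sub>1 \<iota>\<^sub>2 \<iota>\<^sub>1 U\<^sub>2 U\<^sub>1 E\<^sub>2 E\<^sub>1 \<psi> \<phi> by (rule inverse)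
  note KP = A1.K_props
  have iK: "interior K\<^sub>1 \<subseteq> K\<^sub>1" by (rule interior_subset)
  have ch: "character_on A1.B (A1.\<Theta> p s)" if "p \<in> K\<^sub>1" "cmod s < A1.rad" for p s
    using A1.Theta_char id1 that by blast
  have H1: "H\<^sub>1 p s \<in> K\<^sub>2" and H2: "cmod (H\<^sub>2 p s) \<le> A2.rad" if "p \<in> K\<^sub>1" "cmod s < A1.rad" for p s
    using A2.character_eval(1)[OF psi_character[OF ch[OF that]]]
      A2.character_U_le[OF psi_character[OF ch[OF that]]]
    by (simp_all add: H\<^sub>1_def H\<^sub>2_def)
  \<comment> \<open>The fibre coordinate on the way back; applied to \<open>H\<^sub>1\<close> and
    \<open>H\<^sub>2\<close> it returns the parameter \<open>s\<close>.\<close>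
  define F where "F q s = A2.\<Theta> q s (\<phi> U\<^sub>1)" for q s
  have FH: "F (H\<^sub>1 p s) (H\<^sub>2 p s) = s"
    if "p \<in> K\<^sub>1" "cmod s < A1.rad" "cmod (H\<^sub>2 p s) < A2.rad" for p s
    using character_eq_Theta[OF ch[OF that(1,2)] _ _ phi_in[OF A1.U_in_B]] that id2[OF H1[OF that(1,2)]]
    by (simp add: H\<^sub>1_def H\<^sub>2_def F_def psi_phi A1.U_in_B A1.Theta_U)
  have F: "cmod (F q s) \<le> A1.rad" if "q \<in> K\<^sub>2" "cmod s < A2.rad" for q s
    using A1.character_U_le[OF inv.psi_character[OF A2.Theta_char[OF that(1) id2[OF that(1)] that(2)]]]
    by (simp add: F_def)
  obtain M where M: "\<And>q. q \<in> K\<^sub>2 \<Longrightarrow> cmod q \<le> M"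
    using compact_imp_bounded[OF A2.compact_space] unfolding bounded_iff by blast
  obtain \<alpha> r where \<alpha>: "\<alpha> holomorphic_on interior K\<^sub>1" "strict_mono (r :: nat \<Rightarrow> nat)"
    "\<And>z. z \<in> interior K\<^sub>1 \<Longrightarrow> (\<lambda>n. H\<^sub>1 z (w (r n))) \<longlonglongrightarrow> \<alpha> z"
  proof (rule holomorphic_bounded_subsequence[OF KP(1), of "\<lambda>n z. H\<^sub>1 z (w n)" M])
    show "(\<lambda>z. H\<^sub>1 z (w n)) holomorphic_on interior K\<^sub>1" for n
      using A1.Theta_analytic[OF psi_in[OF ident_in_B(2)] w(1)] by (simp add: H\<^sub>1_def analytic_fun_iff)
    show "z \<in> interior K\<^sub>1 \<Longrightarrow> cmod (H\<^sub>1 z (w n)) \<le> M" for n z using M H1 w(1) iK by blast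
  qed (rule that)
  obtain \<beta> r' where \<beta>: "\<beta> holomorphic_on interior K\<^sub>1" "strict_mono (r' :: nat \<Rightarrow> nat)"
    "\<And>z. z \<in> interior K\<^sub>1 \<Longrightarrow> (\<lambda>n. H\<^sub>2 z (w (r (r' n)))) \<longlonglongrightarrow> \<beta> z"
  proof (rule holomorphic_bounded_subsequence[OF KP(1), of "\<lambda>n z. H\<^sub>2 z (w (r n))" A2.rad])
    show "(\<lambda>z. H\<^sub>2 z (w (r n))) holomorphic_on interior K\<^sub>1" for n
      using A1.Theta_analytic[OF psi_in[OF A2.U_in_B] w(1)] by (simp add: H\<^sub>2_def analytic_fun_iff)
    show "z \<in> interior K\<^sub>1 \<Longrightarrow> cmod (H\<^sub>2 z (w (r n))) \<le> A2.rad" for n z using H2 w(1) iK by blast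
  qed (rule that)
  define s where "s n = w (r (r' n))" for n
  have sm: "strict_mono (r \<circ> r')" using \<alpha>(2) \<beta>(2) by (rule strict_mono_o)
  have s: "cmod (s n) < A1.rad" "s \<longlonglongrightarrow> l" for n
    using w(1) LIMSEQ_subseq_LIMSEQ[OF w(2) sm] by (simp_all add: s_def[abs_def] o_def)
  have a: "(\<lambda>n. H\<^sub>1 z (s n)) \<longlonglongrightarrow> \<alpha> z" and b: "(\<lambda>n. H\<^sub>2 z (s n)) \<longlonglongrightarrow> \<beta> z" if "z \<in> interior K\<^sub>1" for z
    using LIMSEQ_subseq_LIMSEQ[OF \<alpha>(3)[OF that] \<beta>(2)] \<beta>(3)[OF that] by (simp_all add: s_def o_def)
  have aK: "\<alpha> z \<in> K\<^sub>2" if "z \<in> interior K\<^sub>1" for z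
    by (rule closed_sequentially[OF compact_imp_closed[OF A2.compact_space] _ a[OF that]])
      (use H1 s(1) iK that in blast)
  have b_le: "cmod (\<beta> z) \<le> A2.rad" if "z \<in> interior K\<^sub>1" for z
    by (rule LIMSEQ_le_const2[OF tendsto_norm[OF b[OF that]]]) (use H2 s(1) iK that in blast)
  have "\<alpha> constant_on interior K\<^sub>1 \<or> \<beta> constant_on interior K\<^sub>1"
  proof (rule ccontr)
    assume "\<not> ?thesis"
    then have an: "\<not> \<alpha> constant_on interior K\<^sub>1" and bn: "\<not> \<beta> constant_on interior K\<^sub>1" by auto
    define \<Omega> where "\<Omega> = interior K\<^sub>1 \<inter> \<beta> -` ball 0 A2.rad"
    have o\<Omega>: "open \<Omega>" unfolding \<Omega>_def
      using \<beta>(1) by (intro continuous_open_preimage holomorphic_on_imp_continuous_on) auto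
    have "open (\<alpha> ` \<Omega>)"
      by (rule open_mapping_thm[OF \<alpha>(1) KP(1,2) o\<Omega> _ an]) (simp add: \<Omega>_def)
    moreover have "\<alpha> ` \<Omega> \<subseteq> K\<^sub>2" using aK by (auto simp: \<Omega>_def)
    ultimately have ai: "\<alpha> ` \<Omega> \<subseteq> interior K\<^sub>2" by (simp add: interior_maximal)
    have "open (\<beta> ` interior K\<^sub>1)" by (rule open_mapping_thm[OF \<beta>(1) KP(1,2) KP(1) order_refl bn])
    then have "\<beta> ` interior K\<^sub>1 \<subseteq> interior (cball 0 A2.rad)"
      using b_le by (intro interior_maximal) auto
    then have "\<Omega> = interior K\<^sub>1" by (auto simp: \<Omega>_def)
    then obtain z where z: "z \<in> \<Omega>" using KP(3) by blast
    then have zi: "z \<in> interior K\<^sub>1" "cmod (\<beta> z) < A2.rad" "\<alpha> z \<in> interior K\<^sub>2" using ai by (auto simp: \<Omega>_def)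
    have aK2: "\<alpha> z \<in> K\<^sub>2" by (rule aK[OF zi(1)])
    have ev: "\<forall>\<^sub>F n in sequentially. cmod (H\<^sub>2 z (s n)) < A2.rad"
      using order_tendstoD(2)[OF tendsto_norm[OF b[OF zi(1)]] zi(2)] .
    have zK: "z \<in> K\<^sub>1" using zi iK by blast
    \<comment> \<open>The limit point lies over the open disc, where \<open>F\<close> is continuous.
      Hence \<open>F (\<alpha> z) (\<beta> z) = l\<close>, and |F| attains its bound
      \<open>A1.rad\<close> at an interior point of the product.\<close>
    have "(\<lambda>n. F (fst (H\<^sub>1 z (s n), H\<^sub>2 z (s n))) (snd (H\<^sub>1 z (s n), H\<^sub>2 z (s n)))) \<longlonglongrightarrow>
        F (fst (\<alpha> z, \<beta> z)) (snd (\<alpha> z, \<beta> z))"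
      unfolding F_def
    proof (rule continuous_on_tendsto_compose[OF A2.Theta_continuous])
      show "(\<lambda>n. (H\<^sub>1 z (s n), H\<^sub>2 z (s n))) \<longlonglongrightarrow> (\<alpha> z, \<beta> z)"
        by (rule tendsto_Pair[OF a[OF zi(1)] b[OF zi(1)]])
      show "(\<alpha> z, \<beta> z) \<in> K\<^sub>2 \<times> ball 0 A2.rad" using aK2 zi by simp
      show "\<forall>\<^sub>F n in sequentially. (H\<^sub>1 z (s n), H\<^sub>2 z (s n)) \<in> K\<^sub>2 \<times> ball 0 A2.rad"
        using ev by eventually_elim (use H1[OF zK s(1)] in simp)
    qed
    then have "(\<lambda>n. F (H\<^sub>1 z (s n)) (H\<^sub>2 z (s n))) \<longlonglongrightarrow> F (\<alpha> z) (\<beta> z)" by simp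
    moreover have "\<forall>\<^sub>F n in sequentially. F (H\<^sub>1 z (s n)) (H\<^sub>2 z (s n)) = s n"
      using ev by eventually_elim (use FH[OF zK s(1)] in simp)
    ultimately have "s \<longlonglongrightarrow> F (\<alpha> z) (\<beta> z)" by (rule Lim_transform_eventually)
    then have Fl: "F (\<alpha> z) (\<beta> z) = l" using s(2) LIMSEQ_unique by blast
    \<comment> \<open>The maximum principle, first in the fibre variable and then in the base
      variable, makes \<open>F\<close> constant with the nonzero value \<open>l\<close>, which
      \<open>Theta_U_not_constant\<close> for the inverse excludes.\<close>
    have F1: "F (\<alpha> z) t = l" if t: "cmod t < A2.rad" for t
    proof -
      have "F (\<alpha> z) constant_on ball 0 A2.rad"
      proof (rule maximum_modulus_principle[of _ _ "ball 0 A2.rad" "\<beta> z"])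
        show "F (\<alpha> z) holomorphic_on ball 0 A2.rad"
          using A2.Theta_holomorphic[OF aK2] by (simp add: F_def[abs_def])
        show "cmod (F (\<alpha> z) t) \<le> cmod (F (\<alpha> z) (\<beta> z))" if "t \<in> ball 0 A2.rad" for t
          using F[OF aK2] that Fl w(3) by simp
      qed (use zi in auto)
      then show ?thesis using Fl zi t unfolding constant_on_def by (metis mem_ball_0)
    qed
    have F2: "F q t = l" if q: "q \<in> K\<^sub>2" and t: "cmod t < A2.rad" for q t
    proof -
      have "F q t = F (\<alpha> z) t"
      proof (rule closed_cauchy_domain_max_constI[OF A2.K_cauchy _ zi(3) _ q, of "\<lambda>q. F q t"])
        show "(\<lambda>q. F q t) \<in> analytic_fun K\<^sub>2"
          unfolding F_def by (rule A2.Theta_analytic[OF phi_in[OF A1.U_in_B] t])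
        show "cmod (F x t) \<le> cmod (F (\<alpha> z) t)" if "x \<in> K\<^sub>2" for x
          using F[OF that t] F1[OF t] w(3) by simp
      qed
      then show ?thesis using F1[OF t] by simp
    qed
    have "l = 0" by (rule inv.Theta_U_not_constant[OF id2]) (use F2 in \<open>simp_all add: F_def\<close>)
    then show False using w(3) A1.rad_pos by simp
  qed
  then have "(\<alpha> z1 - \<alpha> z0) * (\<beta> z2 - \<beta> z0) = 0" using z unfolding constant_on_def by auto
  moreover have "(\<lambda>n. (H\<^sub>1 z1 (s n) - H\<^sub>1 z0 (s n)) * (H\<^sub>2 z2 (s n) - H\<^sub>2 z0 (s n))) \<longlonglongrightarrow>
      (\<alpha> z1 - \<alpha> z0) * (\<beta> z2 - \<beta> z0)"
    by (intro tendsto_intros a b z)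
  ultimately have "(\<lambda>n. (H\<^sub>1 z1 (s n) - H\<^sub>1 z0 (s n)) * (H\<^sub>2 z2 (s n) - H\<^sub>2 z0 (s n))) \<longlonglongrightarrow> 0"
    by (simp only:)
  then show ?thesis using sm by (intro exI[of _ "r \<circ> r'"]) (simp add: s_def)
qed

text \<open>At \<open>w = 0\<close> the series reduce to the core, with the values \<open>y\<close>
  and \<open>v\<close>. The product of the differences is holomorphic in \<open>w\<close> and tends
  to 0 along subsequences at the circle, so it vanishes at 0; letting the points in the two factors
  vary independently turns this into constancy of \<open>y\<close> or of \<open>v\<close>.\<close>

lemma y_or_v_constant:
  assumes id1: "\<And>p. p \<in> K\<^sub>1 \<Longrightarrow> \<eta>\<^sub>1 p = p" and id2: "\<And>q. q \<in> K\<^sub>2 \<Longrightarrow> \<eta>\<^sub>2 q = q"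
  shows "y constant_on interior K\<^sub>1 \<or> v constant_on interior K\<^sub>1"
proof -
  have iK: "interior K\<^sub>1 \<subseteq> K\<^sub>1" by (rule interior_subset)
  have "(y z1 - y z0) * (v z2 - v z0) = 0"
    if z: "z0 \<in> interior K\<^sub>1" "z1 \<in> interior K\<^sub>1" "z2 \<in> interior K\<^sub>1" for z0 z1 z2
  proof -
    define f where "f w = (A1.\<Theta> z1 w (\<psi> (\<iota>\<^sub>2 (\<lambda>z. z))) - A1.\<Theta> z0 w (\<psi> (\<iota>\<^sub>2 (\<lambda>z. z)))) *
      (A1.\<Theta> z2 w (\<psi> U\<^sub>2) - A1.\<Theta> z0 w (\<psi> U\<^sub>2))" for w
    have "f holomorphic_on ball 0 A1.rad"
      unfolding f_def using z iK by (intro holomorphic_intros A1.Theta_holomorphic) auto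
    then have "f 0 = 0"
      using Theta_boundary_product[OF id1 id2 z] A1.rad_pos
      by (intro holomorphic_vanishing_at_circle[of f A1.rad]) (simp_all add: f_def)
    then show ?thesis by (simp add: f_def A1.Theta_0 y_def v_def)
  qed
  then show ?thesis unfolding constant_on_def by (metis eq_iff_diff_eq_0 mult_eq_0_iff)
qed

text \<open>Here \<open>v\<close> is a constant \<open>s\<close>. If |s| were \<open>A2.rad\<close>,
  the maximum principle in the fibre variable would give \<open>\<psi> U\<^sub>2\<close> the value
  \<open>s\<close> at all power series characters, and then \<open>s\<close> would be 0.\<close>

lemma conjugate_if_commutative:
  assumes id1: "\<And>p. p \<in> K\<^sub>1 \<Longrightarrow> \<eta>\<^sub>1 p = p" and id2: "\<And>q. q \<in> K\<^sub>2 \<Longrightarrow> \<eta>\<^sub>2 q = q"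
    and ync: "\<not> y constant_on interior K\<^sub>1" and v: "p0 \<in> K\<^sub>1" "v p0 \<noteq> 0"
  shows "\<exists>x. homeomorphism K\<^sub>1 K\<^sub>2 y x \<and> (\<forall>p\<in>K\<^sub>1. y (\<eta>\<^sub>1 p) = \<eta>\<^sub>2 (y p))"
proof -
  interpret inv: conjugacy_isomorphism K\<^sub>2 K\<^sub>1 \<eta>\<^sub>2 \<eta>\<^sub>1 \<iota>\<^sub>2 \<iota>\<^sub>1 U\<^sub>2 U\<^sub>1 E\<^sub>2 E\<^sub>1 \<psi> \<phi> by (rule inverse)
  define s where "s = v p0"
  have vs: "v p = s" if "p \<in> K\<^sub>1" for p
    using closed_cauchy_domain_constI[OF A1.K_cauchy v_analytic _ that v(1)] y_or_v_constant[OF id1 id2] ync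
    by (auto simp: s_def)
  have s_lt: "cmod s < A2.rad"
  proof (rule ccontr)
    assume "\<not> ?thesis"
    then have s_eq: "cmod s = A2.rad" using v_le[OF v(1)] by (simp add: s_def)
    have const: "A1.\<Theta> z w (\<psi> U\<^sub>2) = s" if z: "z \<in> K\<^sub>1" and w: "cmod w < A1.rad" for z w
    proof -
      have z0: "A1.\<Theta> z 0 (\<psi> U\<^sub>2) = s" using vs[OF z] by (simp add: A1.Theta_0 v_def)
      have "(\<lambda>w. A1.\<Theta> z w (\<psi> U\<^sub>2)) constant_on ball 0 A1.rad"
      proof (rule maximum_modulus_principle[OF A1.Theta_holomorphic[OF z], of "ball 0 A1.rad" 0])
        show "cmod (A1.\<Theta> z t (\<psi> U\<^sub>2)) \<le> cmod (A1.\<Theta> z 0 (\<psi> U\<^sub>2))" if "t \<in> ball 0 A1.rad" for t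
          using A2.character_U_le[OF psi_character[OF A1.Theta_char[OF z id1[OF z], of t]]] that z0 s_eq by simp
      qed (use A1.rad_pos in auto)
      then show ?thesis using z0 w A1.rad_pos unfolding constant_on_def by (metis mem_ball_0 norm_zero)
    qed
    have "s = 0" by (rule Theta_U_not_constant[OF id1 const])
    then show False using v by (simp add: s_def)
  qed
  \<comment> \<open>The inverse of \<open>y\<close>, read off on the slice of the second character
    space over \<open>s\<close>.\<close>
  define x where "x q = A2.\<Theta> q s (\<phi> (\<iota>\<^sub>1 (\<lambda>z. z)))" for q
  have xA: "x \<in> analytic_fun K\<^sub>2"
    using A2.Theta_analytic[OF phi_in[OF ident_in_B(1)] s_lt] by (simp add: x_def[abs_def])
  have xim: "x ` K\<^sub>2 \<subseteq> K\<^sub>1"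
    using A1.character_eval(1)[OF inv.psi_character[OF A2.Theta_char[OF _ id2 s_lt]]] by (auto simp: x_def)
  have xy: "x (y p) = p" if p: "p \<in> K\<^sub>1" for p
  proof -
    have "E\<^sub>1 (\<psi> (\<phi> (\<iota>\<^sub>1 (\<lambda>z. z)))) p = A2.\<Theta> (y p) (v p) (\<phi> (\<iota>\<^sub>1 (\<lambda>z. z)))"
      using character_eq_Theta[OF A1.E0_char[OF p] _ _ phi_in[OF ident_in_B(1)]] vs[OF p] s_lt id2[OF y_in[OF p]]
      by (simp add: y_def[symmetric] v_def[symmetric])
    then show ?thesis using p vs[OF p] by (simp add: x_def psi_phi ident_in_B A1.E0_iota A1.analytic_cont)
  qed
  have "homeomorphism K\<^sub>1 K\<^sub>2 y x"
    by (rule closed_cauchy_domain_homeomorphism[OF A1.K_cauchy A2.K_cauchy y_analytic y_image xA xim xy])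
  then show ?thesis using id1 id2 y_in by auto
qed

section \<open>Combination of the cases\<close>

lemma conjugate:
  assumes "\<not> simply_connected K\<^sub>1"
  shows "\<exists>x. homeomorphism K\<^sub>1 K\<^sub>2 y x \<and> (\<forall>p\<in>K\<^sub>1. y (\<eta>\<^sub>1 p) = \<eta>\<^sub>2 (y p))"
proof (cases "\<forall>p\<in>K\<^sub>1. v p = 0")
  case True
  then show ?thesis using conjugate_if_core_preserved by blast
next
  case False
  then obtain p0 where p0: "p0 \<in> K\<^sub>1" "v p0 \<noteq> 0" by blast
  note KP = A1.K_props and LP = A2.K_props
  have ync: "\<not> y constant_on interior K\<^sub>1"
    using y_constant_imp_simply_connected assms by blast
  define W where "W = interior K\<^sub>1 \<inter> v -` (- {0})"
  have "v holomorphic_on interior K\<^sub>1" using v_analytic by (simp add: analytic_fun_iff)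
  then have oW: "open W"
    unfolding W_def by (intro continuous_open_preimage holomorphic_on_imp_continuous_on) auto
  have "W \<noteq> {}"
  proof
    assume "W = {}"
    then have "v p0 = 0"
      by (intro closed_cauchy_domain_eqI[OF A1.K_cauchy v_analytic analytic_fun_const KP(1,3) order_refl _ p0(1)])
        (auto simp: W_def)
    then show False using p0 by simp
  qed
  have "y holomorphic_on interior K\<^sub>1" using y_analytic by (simp add: analytic_fun_iff)
  then have oy: "open (y ` W)"
    by (rule open_mapping_thm[OF _ KP(1,2) oW _ ync]) (simp add: W_def)
  have "y ` interior K\<^sub>1 \<subseteq> interior K\<^sub>2"
    using y_in interior_subset by (intro analytic_fun_maps_interior[OF KP(2) y_analytic ync]) blast
  then have yW: "y ` W \<subseteq> interior K\<^sub>2" by (auto simp: W_def)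
  have "\<eta>\<^sub>2 (y p) = y p" if "p \<in> W" for p
    using y_fixed[of p] that interior_subset by (auto simp: W_def)
  then have id2: "\<eta>\<^sub>2 q = q" if "q \<in> K\<^sub>2" for q
    using \<open>W \<noteq> {}\<close>
    by (intro closed_cauchy_domain_eqI[OF A2.K_cauchy A2.eta_analytic analytic_fun_ident oy _ yW _ that]) auto
  interpret inv: conjugacy_isomorphism K\<^sub>2 K\<^sub>1 \<eta>\<^sub>2 \<eta>\<^sub>1 \<iota>\<^sub>2 \<iota>\<^sub>1 U\<^sub>2 U\<^sub>1 E\<^sub>2 E\<^sub>1 \<psi> \<phi> by (rule inverse)
  have "\<eta>\<^sub>1 p = p" if "p \<in> K\<^sub>1" for p using inv.eta_ident_transfer[OF id2 that] by blast
  then show ?thesis using conjugate_if_commutative[OF _ id2 ync p0] by blast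
qed

end

theorem theorem5p7:
  fixes K\<^sub>1 K\<^sub>2 :: "complex set"
    and \<eta>\<^sub>1 \<eta>\<^sub>2 :: "complex \<Rightarrow> complex"
    and \<iota>\<^sub>1 :: "(complex \<Rightarrow> complex) \<Rightarrow> 'a::complex_banach_algebra_1"
    and \<iota>\<^sub>2 :: "(complex \<Rightarrow> complex) \<Rightarrow> 'b::complex_banach_algebra_1"
    and U\<^sub>1 :: 'a and U\<^sub>2 :: 'b
    and E\<^sub>1 :: "'a \<Rightarrow> complex \<Rightarrow> complex"
    and E\<^sub>2 :: "'b \<Rightarrow> complex \<Rightarrow> complex"
  assumes "K\<^sub>1 \<in> closed_cauchy_domains" and "K\<^sub>2 \<in> closed_cauchy_domains"
    and "continuous_on K\<^sub>1 \<eta>\<^sub>1" and "\<eta>\<^sub>1 ` K\<^sub>1 \<subseteq> K\<^sub>1" and "\<eta>\<^sub>1 analytic_on interior K\<^sub>1"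
    and "continuous_on K\<^sub>2 \<eta>\<^sub>2" and "\<eta>\<^sub>2 ` K\<^sub>2 \<subseteq> K\<^sub>2" and "\<eta>\<^sub>2 analytic_on interior K\<^sub>2"
    and "topological_conjugacy_algebra K\<^sub>1 \<eta>\<^sub>1 \<iota>\<^sub>1 U\<^sub>1 E\<^sub>1"
    and "topological_conjugacy_algebra K\<^sub>2 \<eta>\<^sub>2 \<iota>\<^sub>2 U\<^sub>2 E\<^sub>2"
    and "\<not> simply_connected K\<^sub>1"
    and "isomorphic_algebras (conj_subalgebra \<iota>\<^sub>1 U\<^sub>1 (analytic_fun K\<^sub>1))
                             (conj_subalgebra \<iota>\<^sub>2 U\<^sub>2 (analytic_fun K\<^sub>2))"
  shows "\<exists>\<gamma> \<gamma>'. homeomorphism K\<^sub>1 K\<^sub>2 \<gamma> \<gamma>' \<and> \<gamma> analytic_on interior K\<^sub>1 \<and>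
           (\<forall>z\<in>K\<^sub>1. \<gamma> (\<eta>\<^sub>1 z) = \<eta>\<^sub>2 (\<gamma> z))"
proof -
  interpret A1: analytic_conjugacy_algebra K\<^sub>1 \<eta>\<^sub>1 \<iota>\<^sub>1 U\<^sub>1 E\<^sub>1
    using assms by (intro analytic_conjugacy_algebra.intro analytic_conjugacy_algebra_axioms.intro)
      (auto simp: analytic_fun_def)
  interpret A2: analytic_conjugacy_algebra K\<^sub>2 \<eta>\<^sub>2 \<iota>\<^sub>2 U\<^sub>2 E\<^sub>2
    using assms by (intro analytic_conjugacy_algebra.intro analytic_conjugacy_algebra_axioms.intro)
      (auto simp: analytic_fun_def)
  obtain \<phi> where iso: "algebra_isomorphism A1.B A2.B \<phi>"
    using assms(12) unfolding isomorphic_algebras_def A1.B_def A2.B_def by blast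
  then have "bij_betw \<phi> A1.B A2.B" unfolding algebra_isomorphism_def by blast
  then interpret conjugacy_isomorphism K\<^sub>1 K\<^sub>2 \<eta>\<^sub>1 \<eta>\<^sub>2 \<iota>\<^sub>1 \<iota>\<^sub>2 U\<^sub>1 U\<^sub>2 E\<^sub>1 E\<^sub>2 \<phi> "inv_into A1.B \<phi>"
    using iso by unfold_locales (auto simp: bij_betw_inv_into_left bij_betw_inv_into_right)
  obtain x where "homeomorphism K\<^sub>1 K\<^sub>2 y x" "\<forall>p\<in>K\<^sub>1. y (\<eta>\<^sub>1 p) = \<eta>\<^sub>2 (y p)"
    using conjugate assms(11) by blast
  moreover have "y analytic_on interior K\<^sub>1" using y_analytic by (simp add: analytic_fun_def)
  ultimately show ?thesis by blast
qed

end
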